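(* For all $k\ge 1$, $$I^1_{12\dots k}(x)=\frac{1}{U_k\left(\frac{1}{2x}\right)},$$ where $I^1_{12\dots k}(x)=\sum_{n\ge 0}I^1_{12\dots k}(n)x^n$ and $I^1_{12\dots k}(n)$ is the number of involutions in $S_n$ that avoid $132$ and contain $12\dots k$ exactly once.
   Context: $S_n$ is the set of permutations of $\{1,\dots,n\}$. An occurrence of a pattern $\tau\in S_k$ in $\alpha\in S_n$ is a choice of indices $1\le i_1<\dots<i_k\le n$ such that $(\alpha_{i_1},\dots,\alpha_{i_k})$ is order-isomorphic to $\tau$; $\alpha$ avoids $\tau$ if it has no occurrence, and contains $\tau$ exactly once if it has exactly one occurrence. An involution is a permutation equal to its own inverse. $U_r$ denotes the Chebyshev polynomial of the second kind, $U_r(\cos\theta)=\sin((r+1)\theta)/\sin\theta$. The identity is one of rational functions, expanded as power series in $x$. *)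

theory Defs
  imports
    Complex_Main
    "HOL-Combinatorics.Permutations"
    "HOL-Computational_Algebra.Formal_Laurent_Series"
begin

definition order_isomorphic :: "nat list \<Rightarrow> nat list \<Rightarrow> bool" where
  "order_isomorphic xs ys \<longleftrightarrow>
     length xs = length ys \<and>
     (\<forall>a < length xs. \<forall>b < length xs. xs ! a < xs ! b \<longleftrightarrow> ys ! a < ys ! b)"

text \<open>
  Elements of $S_n$ are functions \<open>\<alpha>\<close> with \<open>\<alpha> permutes {1..n}\<close>; a pattern is given
  by its one-line notation.  An occurrence is the list of its indices
  $i_1 < \dots < i_k$, counted from 1.
\<close>

definition occurrences :: "nat list \<Rightarrow> nat \<Rightarrow> (nat \<Rightarrow> nat) \<Rightarrow> nat list set" where
  "occurrences \<tau> n \<alpha> =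
     {is. sorted_wrt (<) is \<and> set is \<subseteq> {1..n} \<and> order_isomorphic (map \<alpha> is) \<tau>}"

definition avoids :: "nat list \<Rightarrow> nat \<Rightarrow> (nat \<Rightarrow> nat) \<Rightarrow> bool" where
  "avoids \<tau> n \<alpha> \<longleftrightarrow> occurrences \<tau> n \<alpha> = {}"

definition contains_once :: "nat list \<Rightarrow> nat \<Rightarrow> (nat \<Rightarrow> nat) \<Rightarrow> bool" where
  "contains_once \<tau> n \<alpha> \<longleftrightarrow> card (occurrences \<tau> n \<alpha>) = 1"

definition involutions_once :: "nat list \<Rightarrow> nat \<Rightarrow> (nat \<Rightarrow> nat) set" where
  "involutions_once \<tau> n =
     {\<alpha>. \<alpha> permutes {1..n} \<and> inv \<alpha> = \<alpha> \<and> avoids [1, 3, 2] n \<alpha> \<and> contains_once \<tau> n \<alpha>}"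

definition involutions_once_gf :: "nat list \<Rightarrow> real fps" where
  "involutions_once_gf \<tau> = Abs_fps (\<lambda>n. of_nat (card (involutions_once \<tau> n)))"

definition chebyshev_U :: "nat \<Rightarrow> real poly" where
  "chebyshev_U r =
     (THE p. \<forall>\<theta>. sin \<theta> \<noteq> 0 \<longrightarrow> poly p (cos \<theta>) = sin ((real r + 1) * \<theta>) / sin \<theta>)"

lemma chebyshev_U_exists:
  "\<exists>p :: real poly. \<forall>\<theta>. sin \<theta> \<noteq> 0 \<longrightarrow> poly p (cos \<theta>) = sin ((real r + 1) * \<theta>) / sin \<theta>"
proof (induction r rule: less_induct)
  case (less r)
  show ?case
  proof (cases "r \<le> 1")
    case True
    then consider "r = 0" | "r = 1" by linarith
    then show ?thesis
    proof cases
      case 1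
      then show ?thesis by (intro exI[of _ 1]) auto
    next
      case 2
      then show ?thesis by (intro exI[of _ "[:0, 2:]"]) (auto simp: sin_double)
    qed
  next
    case False
    define m where "m = r - 2"
    with False have r: "r = Suc (Suc m)" by simp
    obtain p :: "real poly" where
      p: "\<And>\<theta>. sin \<theta> \<noteq> 0 \<Longrightarrow> poly p (cos \<theta>) = sin ((real m + 1) * \<theta>) / sin \<theta>"
      using less[of m] r by auto
    obtain q :: "real poly" where
      q: "\<And>\<theta>. sin \<theta> \<noteq> 0 \<Longrightarrow> poly q (cos \<theta>) = sin ((real (Suc m) + 1) * \<theta>) / sin \<theta>"
      using less[of "Suc m"] r by auto
    have "poly ([:0, 2:] * q - p) (cos \<theta>) = sin ((real r + 1) * \<theta>) / sin \<theta>"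
      if "sin \<theta> \<noteq> 0" for \<theta>
    proof -
      define y where "y = (real (Suc m) + 1) * \<theta>"
      have 1: "(real r + 1) * \<theta> = y + \<theta>" "(real m + 1) * \<theta> = y - \<theta>"
        by (simp_all add: y_def r algebra_simps)
      show ?thesis
        unfolding 1 using p[OF that] q[OF that] that unfolding 1 y_def[symmetric]
        by (simp add: sin_add sin_diff field_simps)
    qed
    then show ?thesis by blast
  qed
qed

lemma chebyshev_U_unique:
  fixes p q :: "real poly"
  assumes "\<forall>\<theta>. sin \<theta> \<noteq> 0 \<longrightarrow> poly p (cos \<theta>) = sin ((real r + 1) * \<theta>) / sin \<theta>"
    and "\<forall>\<theta>. sin \<theta> \<noteq> 0 \<longrightarrow> poly q (cos \<theta>) = sin ((real r + 1) * \<theta>) / sin \<theta>"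
  shows "p = q"
proof (rule ccontr)
  assume "p \<noteq> q"
  then have "finite {x. poly (p - q) x = 0}"
    by (intro poly_roots_finite) simp
  moreover have "{-1<..<1} \<subseteq> {x. poly (p - q) x = 0}"
  proof
    fix x :: real
    assume x: "x \<in> {-1<..<1}"
    then have "cos (arccos x) = x" by simp
    moreover have "sin (arccos x) \<noteq> 0" using x by (intro sin_arccos_nonzero) auto
    ultimately show "x \<in> {x. poly (p - q) x = 0}"
      using assms by (metis (mono_tags, lifting) mem_Collect_eq poly_diff right_minus_eq)
  qed
  ultimately have "finite {-1<..<1::real}" by (rule rev_finite_subset)
  then show False using infinite_Ioo[of "-1" "1::real"] by simp
qed

lemma chebyshev_U_cos:
  assumes "sin \<theta> \<noteq> 0"
  shows "poly (chebyshev_U r) (cos \<theta>) = sin ((real r + 1) * \<theta>) / sin \<theta>"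
proof -
  let ?P = "\<lambda>p :: real poly. \<forall>\<theta>. sin \<theta> \<noteq> 0 \<longrightarrow> poly p (cos \<theta>) = sin ((real r + 1) * \<theta>) / sin \<theta>"
  have "\<exists>!p. ?P p"
    using chebyshev_U_exists[of r] chebyshev_U_unique[of _ r] by blast
  then have "?P (chebyshev_U r)"
    unfolding chebyshev_U_def by (rule theI')
  with assms show ?thesis by blast
qed

text \<open>
  Substitution of a Laurent series into a polynomial.  The field of formal Laurent
  series contains the rational functions in $x$ (expanded at 0), and all operations
  on them, such as \<open>1 / (2 * fls_X)\<close>, are the field operations.
\<close>

definition poly_fls :: "real poly \<Rightarrow> real fls \<Rightarrow> real fls" where
  "poly_fls p = poly (map_poly fls_const p)"

end

theory Submission
  imports Defs
begin

text \<open>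
  A permutation avoiding 132 splits at its maximum into a left part lying entirely above the right
  part.  For an involution of length \<open>n\<close> that moves \<open>n\<close>, symmetry repeats the left part \<open>A\<close> together
  with the maximum as a mirror image at the other end, leaving an involution \<open>G\<close> in the middle.  These
  blocks are pairwise incomparable, so increasing subsequences of the two outer blocks come in equal
  numbers; a unique occurrence of \<open>1\<dots>k\<close> therefore lies in \<open>G\<close>, and \<open>A\<close> must avoid
  \<open>1\<dots>(k - 1)\<close>.  If \<open>n\<close> is fixed, removing it leaves a unique occurrence of \<open>1\<dots>(k - 1)\<close>.  With
  \<open>F\<^sub>k\<close> the generating function of the permutations avoiding 132 and \<open>1\<dots>k\<close> this gives
  \<open>F\<^sub>k = 1 + x F\<^sub>k\<^sub>-\<^sub>1 F\<^sub>k\<close> and \<open>I\<^sub>k = x I\<^sub>k\<^sub>-\<^sub>1 + x\<^sup>2 F\<^sub>k\<^sub>-\<^sub>1(x\<^sup>2) I\<^sub>k\<close>, where \<open>I\<^sub>0\<close> is to be read as \<open>1\<close>.  The solutions satisfy \<open>x U\<^sub>k F\<^sub>k(x\<^sup>2) = U\<^sub>k\<^sub>-\<^sub>1\<close> and hence \<open>U\<^sub>k I\<^sub>k = U\<^sub>k\<^sub>-\<^sub>1 I\<^sub>k\<^sub>-\<^sub>1 = 1\<close>, all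
  Chebyshev polynomials being evaluated at \<open>1/(2x)\<close>.
\<close>

section \<open>Graphs of 132-avoiding permutations\<close>

text \<open>Bijections are kept as relations: inversion is then the converse, blocks of a
  permutation are subsets, and gluing blocks is a union.\<close>

definition matching :: "nat set \<Rightarrow> nat set \<Rightarrow> (nat \<times> nat) set \<Rightarrow> bool" where
  "matching X Y P \<longleftrightarrow> single_valued P \<and> single_valued (P\<inverse>) \<and> Domain P = X \<and> Range P = Y"

definition avoids132 :: "(nat \<times> nat) set \<Rightarrow> bool" where
  "avoids132 P \<longleftrightarrow> (\<forall>x y x' y' x'' y''. (x, y) \<in> P \<longrightarrow> (x', y') \<in> P \<longrightarrow> (x'', y'') \<in> P \<longrightarrow>
     x < x' \<longrightarrow> x' < x'' \<longrightarrow> \<not> (y < y'' \<and> y'' < y'))"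

text \<open>The offsets \<open>a\<close> and \<open>b\<close> are arbitrary, so that the blocks of a permutation need not be
  renumbered.\<close>
definition av_graphs :: "nat \<Rightarrow> nat \<Rightarrow> nat \<Rightarrow> (nat \<times> nat) set set" where
  "av_graphs a b n = {P. matching {a<..a + n} {b<..b + n} P \<and> avoids132 P}"

lemma av_graphsD:
  assumes "P \<in> av_graphs a b n" "(x, y) \<in> P"
  shows "a < x" "x \<le> a + n" "b < y" "y \<le> b + n"
proof -
  have "Domain P = {a<..a + n}" "Range P = {b<..b + n}"
    using assms by (auto simp: av_graphs_def matching_def)
  moreover have "x \<in> Domain P" "y \<in> Range P" using assms by auto
  ultimately show "a < x" "x \<le> a + n" "b < y" "y \<le> b + n" by auto
qed

lemma av_graphs_left_unique:
  "P \<in> av_graphs a b n \<Longrightarrow> (x, y) \<in> P \<Longrightarrow> (x', y) \<in> P \<Longrightarrow> x = x'"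
  unfolding av_graphs_def matching_def by (metis (lifting) converseI mem_Collect_eq single_valuedD)

lemma av_graphs_right_unique:
  "P \<in> av_graphs a b n \<Longrightarrow> (x, y) \<in> P \<Longrightarrow> (x, y') \<in> P \<Longrightarrow> y = y'"
  unfolding av_graphs_def matching_def by (metis (lifting) mem_Collect_eq single_valuedD)

lemma av_graphs_pattern:
  "P \<in> av_graphs a b n \<Longrightarrow> (x, y) \<in> P \<Longrightarrow> (x', y') \<in> P \<Longrightarrow> (x'', y'') \<in> P \<Longrightarrow>
    x < x' \<Longrightarrow> x' < x'' \<Longrightarrow> y < y'' \<Longrightarrow> y'' < y' \<Longrightarrow> False"
  unfolding av_graphs_def avoids132_def by blast

lemma av_graphs_Range:
  assumes "P \<in> av_graphs a b n" "b < y" "y \<le> b + n"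
  shows "\<exists>x. (x, y) \<in> P"
proof -
  have "Range P = {b<..b + n}" using assms(1) by (simp add: av_graphs_def matching_def)
  then show ?thesis using assms(2,3) by (auto simp flip: Range_iff)
qed

lemma av_graphs_Domain:
  assumes "P \<in> av_graphs a b n" "a < x" "x \<le> a + n"
  shows "\<exists>y. (x, y) \<in> P"
proof -
  have "Domain P = {a<..a + n}" using assms(1) by (simp add: av_graphs_def matching_def)
  then show ?thesis using assms(2,3) by (auto simp flip: Domain_iff)
qed

lemma av_graphsI:
  assumes "\<And>x y. (x, y) \<in> P \<Longrightarrow> a < x \<and> x \<le> a + n \<and> b < y \<and> y \<le> b + n"
    and "\<And>x y y'. (x, y) \<in> P \<Longrightarrow> (x, y') \<in> P \<Longrightarrow> y = y'"
    and "\<And>x x' y. (x, y) \<in> P \<Longrightarrow> (x', y) \<in> P \<Longrightarrow> x = x'"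
    and "\<And>x. a < x \<Longrightarrow> x \<le> a + n \<Longrightarrow> \<exists>y. (x, y) \<in> P"
    and "\<And>y. b < y \<Longrightarrow> y \<le> b + n \<Longrightarrow> \<exists>x. (x, y) \<in> P"
    and "\<And>x y x' y' x'' y''. (x, y) \<in> P \<Longrightarrow> (x', y') \<in> P \<Longrightarrow> (x'', y'') \<in> P \<Longrightarrow>
      x < x' \<Longrightarrow> x' < x'' \<Longrightarrow> y < y'' \<Longrightarrow> y'' < y' \<Longrightarrow> False"
  shows "P \<in> av_graphs a b n"
proof -
  have "Domain P = {a<..a + n}" "Range P = {b<..b + n}"
    using assms(1,4,5) by (fastforce simp: Domain_iff Range_iff)+
  moreover have "single_valued P" "single_valued (P\<inverse>)"
    using assms(2,3) by (auto simp: single_valued_def)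
  moreover have "avoids132 P" unfolding avoids132_def using assms(6) by blast
  ultimately show ?thesis by (auto simp: av_graphs_def matching_def)
qed

lemma av_graphs_subset: "P \<in> av_graphs a b n \<Longrightarrow> P \<subseteq> {a<..a + n} \<times> {b<..b + n}"
  by (auto dest: av_graphsD)

lemma finite_av_graphs: "finite (av_graphs a b n)"
  by (rule finite_subset[of _ "Pow ({a<..a + n} \<times> {b<..b + n})"]) (use av_graphs_subset in blast, simp)

lemma finite_av_graph: "P \<in> av_graphs a b n \<Longrightarrow> finite P"
  using finite_subset[OF av_graphs_subset] by simp

lemma av_graphs_0: "av_graphs a b 0 = {{}}"
proof -
  have "P = {}" if "P \<in> av_graphs a b 0" for P
    using av_graphsD[OF that] by fastforce
  moreover have "{} \<in> av_graphs a b 0" by (rule av_graphsI) auto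
  ultimately show ?thesis by auto
qed

text \<open>The pattern 132 is its own inverse. Transposing an occurrence gives an occurrence again,
  with its last two points exchanged.\<close>

lemma av_graphs_converse:
  assumes P: "P \<in> av_graphs a b n"
  shows "P\<inverse> \<in> av_graphs b a n"
proof (rule av_graphsI, goal_cases)
  case (1 x y) then show ?case using av_graphsD[OF P, of y x] by simp
next
  case (2 x y y') then show ?case using av_graphs_left_unique[OF P, of y x y'] by auto
next
  case (3 x x' y) then show ?case using av_graphs_right_unique[OF P, of y x x'] by auto
next
  case (4 x) then show ?case using av_graphs_Range[OF P, of x] by blast
next
  case (5 y) then show ?case using av_graphs_Domain[OF P, of y] by blast
next
  case (6 x y x' y' x'' y'') then show ?case
    using av_graphs_pattern[OF P, of y x y'' x'' y' x'] by blast
qed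

text \<open>In an occurrence of 132 the new point would have to be both the last and the largest
  entry, but 132 does not end in its largest entry.\<close>

lemma av_graphs_insert_top:
  assumes "P \<in> av_graphs a b n"
  shows "insert (a + Suc n, b + Suc n) P \<in> av_graphs a b (Suc n)"
proof -
  have bd: "x < a + Suc n" "y < b + Suc n" if "(x, y) \<in> P" for x y
    using av_graphsD[OF assms that] by auto
  show ?thesis
  proof (rule av_graphsI, goal_cases)
    case (1 x y) then show ?case using av_graphsD[OF assms, of x y] by auto
  next
    case (2 x y y') then show ?case
      using bd[of x y] bd[of x y'] av_graphs_right_unique[OF assms, of x y y'] by auto
  next
    case (3 x x' y) then show ?case
      using bd[of x y] bd[of x' y] av_graphs_left_unique[OF assms, of x y x'] by auto
  next
    case (4 x) then show ?case
      using av_graphs_Domain[OF assms, of x] by (cases "x = a + Suc n") auto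
  next
    case (5 x) then show ?case
      using av_graphs_Range[OF assms, of x] by (cases "x = b + Suc n") auto
  next
    case (6 x y x' y' x'' y'')
    have bd': "x < a + Suc n \<or> y < b + Suc n \<longrightarrow> (x, y) \<in> P" "x \<le> a + Suc n" "y \<le> b + Suc n"
      if "(x, y) \<in> insert (a + Suc n, b + Suc n) P" for x y
      using that bd[of x y] by auto
    have "(x, y) \<in> P" "(x', y') \<in> P" "(x'', y'') \<in> P"
      using bd'[OF 6(1)] bd'[OF 6(2)] bd'[OF 6(3)] 6(4-) by linarith+
    then show ?case using 6 av_graphs_pattern[OF assms, of x y x' y' x'' y''] by blast
  qed
qed

lemma av_graphs_remove_top:
  assumes P: "P \<in> av_graphs a b (Suc n)" and t: "(a + Suc n, b + Suc n) \<in> P"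
  shows "P - {(a + Suc n, b + Suc n)} \<in> av_graphs a b n"
proof (rule av_graphsI, goal_cases)
  case (1 x y)
  then have xy: "(x, y) \<in> P" "\<not> (x = a + Suc n \<and> y = b + Suc n)" by auto
  have "x = a + Suc n \<Longrightarrow> y = b + Suc n" "y = b + Suc n \<Longrightarrow> x = a + Suc n"
    using av_graphs_left_unique[OF P _ t, of x] av_graphs_right_unique[OF P _ t, of y] xy(1) by blast+
  then show ?case using av_graphsD[OF P xy(1)] xy(2) by linarith
next
  case (2 x y y') then show ?case using av_graphs_right_unique[OF P, of x y y'] by blast
next
  case (3 x x' y) then show ?case using av_graphs_left_unique[OF P, of x y x'] by blast
next
  case (4 x)
  then obtain y where "(x, y) \<in> P" using av_graphs_Domain[OF P, of x] by auto
  then show ?case using 4 by (intro exI[of _ y]) simp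
next
  case (5 y)
  then obtain x where "(x, y) \<in> P" using av_graphs_Range[OF P, of y] by auto
  then show ?case using 5 by (intro exI[of _ x]) simp
next
  case (6 x y x' y' x'' y'')
  then show ?case using av_graphs_pattern[OF P, of x y x' y' x'' y''] by blast
qed

text \<open>\<open>A\<close> lies to the left of and above \<open>B\<close>. The first entry of 132
  is its smallest, so an occurrence starting in \<open>A\<close> cannot descend into
  \<open>B\<close>, and one starting in \<open>B\<close> cannot go back to the left into
  \<open>A\<close>.\<close>

lemma av_graphs_Un:
  assumes A: "A \<in> av_graphs a (b + m) j" and B: "B \<in> av_graphs (a + j) b m"
  shows "A \<union> B \<in> av_graphs a b (j + m)"
proof -
  have bA: "a < x \<and> x \<le> a + j \<and> b + m < y \<and> y \<le> b + m + j" if "(x, y) \<in> A" for x y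
    using av_graphsD[OF A that] by simp
  have bB: "a + j < x \<and> x \<le> a + j + m \<and> b < y \<and> y \<le> b + m" if "(x, y) \<in> B" for x y
    using av_graphsD[OF B that] by simp
  have AB: "x < x' \<and> y' < y" if "(x, y) \<in> A" "(x', y') \<in> B" for x y x' y'
    using bA[OF that(1)] bB[OF that(2)] by simp
  show ?thesis
  proof (rule av_graphsI, goal_cases)
    case (1 x y) then show ?case using bA[of x y] bB[of x y] by auto
  next
    case (2 x y y') then show ?case
      using AB[of x y x y'] AB[of x y' x y] av_graphs_right_unique[OF A, of x y y']
        av_graphs_right_unique[OF B, of x y y'] by blast
  next
    case (3 x x' y) then show ?case
      using AB[of x y x' y] AB[of x' y x y] av_graphs_left_unique[OF A, of x y x']
        av_graphs_left_unique[OF B, of x y x'] by blast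
  next
    case (4 x) then show ?case
      using av_graphs_Domain[OF A, of x] av_graphs_Domain[OF B, of x] by (cases "x \<le> a + j") auto
  next
    case (5 y) then show ?case
      using av_graphs_Range[OF A, of y] av_graphs_Range[OF B, of y] by (cases "y \<le> b + m") auto
  next
    case (6 x y x' y' x'' y'')
    show ?case
    proof (cases "(x, y) \<in> A")
      case True
      have "\<not> y' < y" "\<not> y'' < y" using 6(6,7) by simp_all
      then have "(x', y') \<in> A" "(x'', y'') \<in> A" using 6(2,3) AB[OF True] by blast+
      then show ?thesis using True 6 av_graphs_pattern[OF A, of x y x' y' x'' y''] by blast
    next
      case False
      then have B': "(x, y) \<in> B" using 6(1) by blast
      have "\<not> x' < x" "\<not> x'' < x" using 6(4,5) by simp_all
      then have "(x', y') \<in> B" "(x'', y'') \<in> B" using 6(2,3) AB[OF _ B'] by blast+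
      with B' show ?thesis using 6 av_graphs_pattern[OF B, of x y x' y' x'' y''] by blast
    qed
  qed
qed

text \<open>Converse of \<open>av_graphs_Un\<close>: the hypothesis makes the cut after column
  \<open>a + j\<close> coincide with the cut above row \<open>b + m\<close>, so two opposite
  quadrants are empty.\<close>

lemma av_graphs_split:
  assumes P: "P \<in> av_graphs a b (j + m)"
    and split: "\<And>x y. (x, y) \<in> P \<Longrightarrow> x \<le> a + j \<longleftrightarrow> b + m < y"
  shows "{p \<in> P. fst p \<le> a + j} \<in> av_graphs a (b + m) j" (is "?A \<in> _")
    and "{p \<in> P. a + j < fst p} \<in> av_graphs (a + j) b m" (is "?B \<in> _")
proof -
  show "?A \<in> av_graphs a (b + m) j"
  proof (rule av_graphsI, goal_cases)
    case (1 x y) then show ?case using av_graphsD[OF P, of x y] split[of x y] by simp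
  next
    case (2 x y y') then show ?case using av_graphs_right_unique[OF P, of x y y'] by auto
  next
    case (3 x x' y) then show ?case using av_graphs_left_unique[OF P, of x y x'] by auto
  next
    case (4 x) then show ?case using av_graphs_Domain[OF P, of x] by simp
  next
    case (5 y)
    then obtain x where "(x, y) \<in> P" using av_graphs_Range[OF P, of y] by auto
    then show ?case using split[of x y] 5 by auto
  next
    case (6 x y x' y' x'' y'') then show ?case using av_graphs_pattern[OF P, of x y x' y' x'' y''] by blast
  qed
  show "?B \<in> av_graphs (a + j) b m"
  proof (rule av_graphsI, goal_cases)
    case (1 x y) then show ?case using av_graphsD[OF P, of x y] split[of x y] by simp
  next
    case (2 x y y') then show ?case using av_graphs_right_unique[OF P, of x y y'] by auto
  next
    case (3 x x' y) then show ?case using av_graphs_left_unique[OF P, of x y x'] by auto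
  next
    case (4 x) then show ?case using av_graphs_Domain[OF P, of x] by simp
  next
    case (5 y)
    then obtain x where "(x, y) \<in> P" using av_graphs_Range[OF P, of y] by auto
    then show ?case using split[of x y] 5 by auto
  next
    case (6 x y x' y' x'' y'') then show ?case using av_graphs_pattern[OF P, of x y x' y' x'' y''] by blast
  qed
qed

text \<open>Entries left of the maximum exceed those right of it, since otherwise the maximum would be
  the 3 of a pattern 132; the threshold between them is then found by counting.\<close>
lemma av_graphs_maximum:
  assumes P: "P \<in> av_graphs a b (Suc n)"
  obtains j m where "j + m = n" "(a + Suc j, b + Suc n) \<in> P"
    "\<And>x y. (x, y) \<in> P \<Longrightarrow> x \<le> a + Suc j \<longleftrightarrow> b + m < y"
proof -
  obtain i where i: "(i, b + Suc n) \<in> P" using av_graphs_Range[OF P, of "b + Suc n"] by auto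
  define j where "j = i - Suc a"
  define m where "m = n - j"
  have ij: "i = a + Suc j" "j + m = n" using av_graphsD[OF P i] by (auto simp: j_def m_def)
  have below: "y' < y" if "(x, y) \<in> P" "(x', y') \<in> P" "x \<le> i" "i < x'" for x y x' y'
  proof (rule ccontr)
    assume "\<not> y' < y"
    moreover have "y \<noteq> y'" using that av_graphs_left_unique[OF P, of x y x'] by auto
    moreover have "y' \<noteq> b + Suc n" using that i av_graphs_left_unique[OF P, of x' y' i] by auto
    moreover have "y' \<le> b + Suc n" using av_graphsD[OF P that(2)] by simp
    ultimately have y: "y < y'" "y' < b + Suc n" by auto
    then have "x \<noteq> i" using that i av_graphs_right_unique[OF P, of x y "b + Suc n"] by auto
    then show False using av_graphs_pattern[OF P that(1) i that(2)] y that by simp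
  qed
  define L where "L = {p \<in> P. fst p \<le> i}"
  define R where "R = {p \<in> P. i < fst p}"
  have inj: "inj_on fst P" "inj_on snd P"
    by (auto intro!: inj_onI dest: av_graphs_left_unique[OF P] av_graphs_right_unique[OF P])
  then have inj': "inj_on fst L" "inj_on snd L" "inj_on fst R" "inj_on snd R"
    by (auto simp: L_def R_def intro: inj_on_subset)
  have "fst ` L = {a<..i}"
  proof (intro equalityI subsetI)
    fix x assume "x \<in> {a<..i}"
    moreover from this obtain y where "(x, y) \<in> P"
      using ij av_graphs_Domain[OF P, of x] by auto
    ultimately show "x \<in> fst ` L" by (force simp: L_def)
  qed (auto simp: L_def dest: av_graphsD(1)[OF P])
  then have cL: "card (snd ` L) = Suc j"
    using card_image[OF inj'(1)] card_image[OF inj'(2)] ij by simp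
  have "fst ` R = {i<..a + Suc n}"
  proof (intro equalityI subsetI)
    fix x assume "x \<in> {i<..a + Suc n}"
    moreover from this obtain y where "(x, y) \<in> P"
      using ij av_graphs_Domain[OF P, of x] by auto
    ultimately show "x \<in> fst ` R" by (force simp: R_def)
  qed (auto simp: R_def dest: av_graphsD(2)[OF P])
  then have cR: "card (snd ` R) = m"
    using card_image[OF inj'(3)] card_image[OF inj'(4)] ij by simp
  show ?thesis
  proof (rule that)
    fix x y assume xy: "(x, y) \<in> P"
    show "x \<le> a + Suc j \<longleftrightarrow> b + m < y"
    proof (cases "x \<le> i")
      case True
      \<comment> \<open>The \<open>m\<close> values to the right of the maximum lie strictly between
        \<open>b\<close> and \<open>y\<close>, which pushes \<open>y\<close> above
        \<open>b + m\<close>.\<close>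
      have "snd ` R \<subseteq> {b<..<y}"
        using below[OF xy _ True] by (auto simp: R_def dest: av_graphsD(3)[OF P])
      then have "m \<le> card {b<..<y}" using card_mono[of "{b<..<y}" "snd ` R"] cR by simp
      then show ?thesis using True ij av_graphsD[OF P xy] by simp
    next
      case False
      \<comment> \<open>Dually, the \<open>Suc j\<close> values up to and including the maximum lie
        above \<open>y\<close> and are at most \<open>b + Suc n\<close>, which keeps
        \<open>y\<close> at or below \<open>b + m\<close>.\<close>
      have "y < y' \<and> y' \<le> b + Suc n" if "(x', y') \<in> L" for x' y'
        using that below[of x' y' x y] xy False av_graphsD(4)[OF P, of x' y'] by (simp add: L_def)
      then have "snd ` L \<subseteq> {y<..b + Suc n}" by auto
      then have "Suc j \<le> card {y<..b + Suc n}" using card_mono[of "{y<..b + Suc n}" "snd ` L"] cL by simp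
      then show ?thesis using False ij by simp
    qed
  next
    show "j + m = n" by (fact ij(2))
    show "(a + Suc j, b + Suc n) \<in> P" using i ij(1) by simp
  qed
qed

section \<open>Increasing chains\<close>

definition strictly_below :: "nat \<times> nat \<Rightarrow> nat \<times> nat \<Rightarrow> bool" where
  "strictly_below p q \<longleftrightarrow> fst p < fst q \<and> snd p < snd q"

text \<open>An increasing subsequence is determined by its set of points, so occurrences of
  \<open>12...k\<close> can be counted as sets, without reference to index lists.\<close>

definition chains :: "nat \<Rightarrow> (nat \<times> nat) set \<Rightarrow> (nat \<times> nat) set set" where
  "chains k P = {C. C \<subseteq> P \<and> finite C \<and> card C = k \<and>
     (\<forall>p\<in>C. \<forall>q\<in>C. p = q \<or> strictly_below p q \<or> strictly_below q p)}"

definition num_chains :: "nat \<Rightarrow> (nat \<times> nat) set \<Rightarrow> nat" where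
  "num_chains k P = card (chains k P)"

lemma finite_chains: "finite P \<Longrightarrow> finite (chains k P)"
  by (rule finite_subset[of _ "Pow P"]) (auto simp: chains_def)

lemma chains_0: "chains 0 P = {{}}"
  by (auto simp: chains_def)

lemma num_chains_0 [simp]: "num_chains 0 P = 1"
  by (simp add: num_chains_def chains_0)

lemma num_chains_Suc_empty [simp]: "num_chains (Suc k) {} = 0"
proof -
  have "chains (Suc k) {} = {}" by (auto simp: chains_def)
  then show ?thesis by (simp add: num_chains_def)
qed

lemma num_chains_1: "num_chains (Suc 0) P = card P"
proof -
  have "chains (Suc 0) P = (\<lambda>p. {p}) ` P" by (auto simp: chains_def card_Suc_eq)
  then show ?thesis by (simp add: num_chains_def card_image)
qed

text \<open>The order \<open>strictly_below\<close> is symmetric in the two coordinates. Hence a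
  block and its mirror image contribute equally many chains.\<close>

lemma num_chains_converse: "num_chains k (P\<inverse>) = num_chains k P"
proof -
  have sub: "converse ` chains k P \<subseteq> chains k (P\<inverse>)" for P
  proof (rule image_subsetI)
    fix C assume C: "C \<in> chains k P"
    have "p = q \<or> strictly_below p q \<or> strictly_below q p" if "p \<in> C\<inverse>" "q \<in> C\<inverse>" for p q
    proof -
      have "prod.swap p \<in> C" "prod.swap q \<in> C" using that by auto
      then have "prod.swap p = prod.swap q \<or> strictly_below (prod.swap p) (prod.swap q) \<or>
          strictly_below (prod.swap q) (prod.swap p)"
        using C unfolding chains_def by blast
      then show ?thesis by (auto simp: strictly_below_def prod_eq_iff)
    qed
    moreover have "C\<inverse> \<subseteq> P\<inverse>" "finite (C\<inverse>)" "card (C\<inverse>) = k"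
      using C by (auto simp: chains_def)
    ultimately show "C\<inverse> \<in> chains k (P\<inverse>)" by (simp add: chains_def)
  qed
  have "bij_betw converse (chains k P) (chains k (P\<inverse>))"
    using sub[of P] sub[of "P\<inverse>"] by (intro bij_betw_byWitness[where f' = converse]) auto
  then show ?thesis unfolding num_chains_def by (simp add: bij_betw_same_card)
qed

text \<open>A chain cannot mix two mutually incomparable sets. The length is a successor because the
  empty chain would be counted on both sides.\<close>

lemma num_chains_Un:
  assumes "finite A" "finite B"
    and "\<And>p q. p \<in> A \<Longrightarrow> q \<in> B \<Longrightarrow> p \<noteq> q \<and> \<not> strictly_below p q \<and> \<not> strictly_below q p"
  shows "num_chains (Suc k) (A \<union> B) = num_chains (Suc k) A + num_chains (Suc k) B"
proof -
  have "C \<subseteq> A \<or> C \<subseteq> B" if C: "C \<in> chains (Suc k) (A \<union> B)" for C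
  proof (rule ccontr)
    assume "\<not> ?thesis"
    then obtain p q where "p \<in> C" "p \<notin> A" "q \<in> C" "q \<notin> B" by blast
    moreover from this have "p \<in> B" "q \<in> A" using C by (auto simp: chains_def)
    ultimately show False using assms(3)[of q p] C by (auto simp: chains_def)
  qed
  then have "chains (Suc k) (A \<union> B) = chains (Suc k) A \<union> chains (Suc k) B"
    by (auto simp: chains_def)
  moreover have "chains (Suc k) A \<inter> chains (Suc k) B = {}"
  proof (intro equals0I)
    fix C assume "C \<in> chains (Suc k) A \<inter> chains (Suc k) B"
    then have "C \<subseteq> A" "C \<subseteq> B" "C \<noteq> {}" by (auto simp: chains_def)
    then show False using assms(3) by blast
  qed
  ultimately show ?thesis
    by (simp add: num_chains_def card_Un_disjoint finite_chains assms)
qed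

text \<open>Chains are sorted by whether they contain \<open>t\<close>. Deleting \<open>t\<close>
  leaves a chain of \<open>A\<close> with one point fewer, and \<open>t\<close> can be put on top of
  any such chain.\<close>

lemma num_chains_insert_top:
  assumes "finite A" and top: "\<And>p. p \<in> A \<Longrightarrow> strictly_below p t"
  shows "num_chains (Suc k) (insert t A) = num_chains (Suc k) A + num_chains k A"
proof -
  have t: "t \<notin> A" using top[of t] by (auto simp: strictly_below_def)
  have 1: "chains (Suc k) (insert t A) = chains (Suc k) A \<union> insert t ` chains k A" (is "?L = ?R")
  proof (intro equalityI subsetI)
    fix C assume C: "C \<in> ?L"
    show "C \<in> ?R"
    proof (cases "t \<in> C")
      case True
      then have "C - {t} \<in> chains k A" using C by (auto simp: chains_def)
      then show ?thesis using True by (intro UnI2 image_eqI[of _ _ "C - {t}"]) auto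
    next
      case False
      then show ?thesis using C by (auto simp: chains_def)
    qed
  next
    fix C assume "C \<in> ?R"
    then consider "C \<in> chains (Suc k) A" | D where "C = insert t D" "D \<in> chains k A" by blast
    then show "C \<in> ?L"
    proof cases
      case 1 then show ?thesis by (auto simp: chains_def)
    next
      case 2
      then have "t \<notin> D" "\<And>p. p \<in> D \<Longrightarrow> strictly_below p t" using t top by (auto simp: chains_def)
      then show ?thesis using 2 by (auto simp: chains_def)
    qed
  qed
  have "chains (Suc k) A \<inter> insert t ` chains k A = {}" using t by (auto simp: chains_def)
  moreover have "inj_on (insert t) (chains k A)"
  proof (rule inj_onI)
    fix C D assume "C \<in> chains k A" "D \<in> chains k A" "insert t C = insert t D"
    moreover from this have "t \<notin> C" "t \<notin> D" using t by (auto simp: chains_def)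
    ultimately show "C = D" by (metis insert_ident)
  qed
  ultimately show ?thesis unfolding num_chains_def 1
    using assms(1) by (simp add: card_Un_disjoint finite_chains card_image)
qed

text \<open>Deleting single points from one chain of \<open>Suc k\<close> points yields
  \<open>Suc k\<close> different chains. The bound, not mere positivity, is what
  \<open>near_once_Suc\<close> relies on.\<close>

lemma num_chains_Suc_pos:
  assumes "finite P" "num_chains (Suc k) P > 0"
  shows "num_chains k P > k"
proof -
  from assms(2) obtain C where C: "C \<in> chains (Suc k) P"
    by (auto simp: num_chains_def card_gt_0_iff)
  then have "card C = Suc k" "finite C" by (auto simp: chains_def)
  have "inj_on (\<lambda>p. C - {p}) C" by (auto intro!: inj_onI)
  then have "card ((\<lambda>p. C - {p}) ` C) = Suc k" using C by (simp add: card_image chains_def)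
  moreover have "(\<lambda>p. C - {p}) ` C \<subseteq> chains k P" using C by (auto simp: chains_def)
  ultimately show ?thesis unfolding num_chains_def
    using card_mono[OF finite_chains[OF assms(1)]] by (metis Suc_le_eq)
qed

lemma num_chains_zero_Suc: "finite P \<Longrightarrow> num_chains k P = 0 \<Longrightarrow> num_chains (Suc k) P = 0"
  using num_chains_Suc_pos[of P k] by linarith

section \<open>Decomposition at the maximum\<close>

text \<open>In one-line notation: \<open>A\<close> of length \<open>j\<close>, then the maximum,
  then \<open>B\<close>. The number \<open>n\<close> counts the entries other than the
  maximum.\<close>

definition join :: "nat \<Rightarrow> nat \<Rightarrow> nat \<Rightarrow> nat \<Rightarrow> (nat \<times> nat) set \<Rightarrow> (nat \<times> nat) set \<Rightarrow> (nat \<times> nat) set"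
  where "join a b n j A B = insert (a + Suc j, b + Suc n) A \<union> B"

lemma join_mem:
  assumes "A \<in> av_graphs a (b + m) j" "B \<in> av_graphs (a + Suc j) b m"
  shows "join a b (j + m) j A B \<in> av_graphs a b (Suc (j + m))"
  using av_graphs_Un[OF av_graphs_insert_top[OF assms(1)] assms(2)]
  by (simp add: join_def algebra_simps)

text \<open>\<open>A\<close> with the maximum lies to the left of and above \<open>B\<close>, so no
  chain meets both; within the left part the maximum dominates all of \<open>A\<close> and extends
  each of its chains.\<close>

lemma num_chains_join:
  assumes A: "A \<in> av_graphs a (b + m) j" and B: "B \<in> av_graphs (a + Suc j) b m"
  shows "num_chains (Suc k) (join a b (j + m) j A B) =
    num_chains (Suc k) A + num_chains k A + num_chains (Suc k) B"
proof -
  have "num_chains (Suc k) (join a b (j + m) j A B) =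
      num_chains (Suc k) (insert (a + Suc j, b + Suc (j + m)) A) + num_chains (Suc k) B"
    unfolding join_def
  proof (rule num_chains_Un)
    fix p q assume "p \<in> insert (a + Suc j, b + Suc (j + m)) A" "q \<in> B"
    then have "fst p < fst q" "snd q < snd p"
      using av_graphsD[OF A, of "fst p" "snd p"] av_graphsD[OF B, of "fst q" "snd q"] by auto
    then show "p \<noteq> q \<and> \<not> strictly_below p q \<and> \<not> strictly_below q p"
      by (auto simp: strictly_below_def)
  qed (use finite_av_graph A B in auto)
  also have "num_chains (Suc k) (insert (a + Suc j, b + Suc (j + m)) A) =
      num_chains (Suc k) A + num_chains k A"
  proof (rule num_chains_insert_top)
    fix p assume "p \<in> A"
    then show "strictly_below p (a + Suc j, b + Suc (j + m))"
      using av_graphsD[OF A, of "fst p" "snd p"] by (simp add: strictly_below_def)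
  qed (use finite_av_graph A in auto)
  finally show ?thesis .
qed

text \<open>Once \<open>j\<close> is known, columns separate the blocks: \<open>A\<close> uses those
  up to \<open>a + j\<close>, and \<open>B\<close> those beyond \<open>a + Suc j\<close>.\<close>

lemma join_inj:
  assumes "A \<in> av_graphs a (b + m) j" "B \<in> av_graphs (a + Suc j) b m"
    and "A' \<in> av_graphs a (b + m) j" "B' \<in> av_graphs (a + Suc j) b m"
    and eq: "join a b (j + m) j A B = join a b (j + m) j A' B'"
  shows "A = A' \<and> B = B'"
proof -
  have *: "A = {p \<in> join a b (j + m) j A B. fst p \<le> a + j} \<and>
    B = {p \<in> join a b (j + m) j A B. a + Suc j < fst p}"
    if A: "A \<in> av_graphs a (b + m) j" and B: "B \<in> av_graphs (a + Suc j) b m" for A B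
  proof -
    have "fst p \<le> a + j" if "p \<in> A" for p using av_graphsD(2)[OF A, of "fst p" "snd p"] that by simp
    moreover have "a + Suc j < fst p" if "p \<in> B" for p
      using av_graphsD(1)[OF B, of "fst p" "snd p"] that by simp
    ultimately show ?thesis by (fastforce simp: join_def)
  qed
  show ?thesis using *[OF assms(1,2)] *[OF assms(3,4)] eq by simp
qed

text \<open>This is \<open>av_graphs_maximum\<close> with the two sides of the cut turned into
  blocks. The last three conclusions locate the blocks inside \<open>P\<close>, so that for an
  involution they can be compared with their transposes.\<close>

lemma av_graphs_join:
  assumes P: "P \<in> av_graphs a b (Suc n)"
  obtains j m A B where "j + m = n" "A \<in> av_graphs a (b + m) j" "B \<in> av_graphs (a + Suc j) b m"
    "P = join a b n j A B" "\<And>x y. (x, y) \<in> P \<Longrightarrow> x \<le> a + Suc j \<longleftrightarrow> b + m < y"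
    "insert (a + Suc j, b + Suc n) A = {p \<in> P. fst p \<le> a + Suc j}"
    "B = {p \<in> P. a + Suc j < fst p}"
proof -
  obtain j m where jm: "j + m = n" "(a + Suc j, b + Suc n) \<in> P"
    and split: "\<And>x y. (x, y) \<in> P \<Longrightarrow> x \<le> a + Suc j \<longleftrightarrow> b + m < y"
    using av_graphs_maximum[OF P] by blast
  define L where "L = {p \<in> P. fst p \<le> a + Suc j}"
  define B where "B = {p \<in> P. a + Suc j < fst p}"
  have P': "P \<in> av_graphs a b (Suc j + m)" using P jm by simp
  have L: "L \<in> av_graphs a (b + m) (Suc j)" and B: "B \<in> av_graphs (a + Suc j) b m"
    unfolding L_def B_def using av_graphs_split[OF P' split] by auto
  define A where "A = L - {(a + Suc j, b + Suc n)}"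
  have top: "(a + Suc j, b + Suc n) \<in> L" using jm by (simp add: L_def)
  have bn: "b + Suc n = b + m + Suc j" using jm by simp
  have A: "A \<in> av_graphs a (b + m) j"
    unfolding A_def using av_graphs_remove_top[OF L] top unfolding bn by blast
  have L': "insert (a + Suc j, b + Suc n) A = L" using top by (auto simp: A_def)
  show ?thesis
  proof (rule that[OF jm(1) A B])
    show "P = join a b n j A B" unfolding join_def L' by (auto simp: L_def B_def)
    show "x \<le> a + Suc j \<longleftrightarrow> b + m < y" if "(x, y) \<in> P" for x y by (fact split[OF that])
    show "insert (a + Suc j, b + Suc n) A = {p \<in> P. fst p \<le> a + Suc j}" by (fact L'[unfolded L_def])
    show "B = {p \<in> P. a + Suc j < fst p}" by (fact B_def)
  qed
qed

text \<open>The column of the largest value reveals \<open>j\<close>. This makes the unions over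
  \<open>j\<close> in the recurrences disjoint.\<close>

lemma join_index:
  assumes "join a b n j A B = join a b n j' A' B'" "join a b n j A B \<in> av_graphs a b (Suc n)"
  shows "j = j'"
proof -
  have "(a + Suc j, b + Suc n) \<in> join a b n j A B" "(a + Suc j', b + Suc n) \<in> join a b n j A B"
    by (simp add: join_def, simp only: assms(1)) (simp add: join_def)
  from av_graphs_left_unique[OF assms(2) this] show ?thesis by simp
qed

section \<open>Counting the permutations that avoid 132 and \<open>12...k\<close>\<close>

definition avoiders :: "nat \<Rightarrow> nat \<Rightarrow> nat \<Rightarrow> nat \<Rightarrow> (nat \<times> nat) set set" where
  "avoiders k a b n = {P \<in> av_graphs a b n. num_chains k P = 0}"

lemma finite_avoiders: "finite (avoiders k a b n)"
  by (simp add: avoiders_def finite_av_graphs)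

lemma avoiders_0_left: "avoiders 0 a b n = {}"
  by (simp add: avoiders_def)

lemma avoiders_0: "avoiders (Suc k) a b 0 = {{}}"
  by (auto simp: avoiders_def av_graphs_0)

text \<open>All three summands of \<open>num_chains_join\<close> must vanish. For \<open>A\<close>
  it suffices to forbid chains of \<open>k\<close> points, since a longer chain contains one of
  these; hence \<open>k\<close> for \<open>A\<close> but \<open>Suc k\<close> for
  \<open>B\<close>.\<close>

lemma avoiders_Suc:
  "avoiders (Suc k) a b (Suc n) =
    (\<Union>j\<le>n. case_prod (join a b n j) ` (avoiders k a (b + (n - j)) j \<times> avoiders (Suc k) (a + Suc j) b (n - j)))"
  (is "?L = ?R")
proof (intro equalityI subsetI)
  fix P assume "P \<in> ?L"
  then have P: "P \<in> av_graphs a b (Suc n)" "num_chains (Suc k) P = 0" by (auto simp: avoiders_def)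
  obtain j m A B where d: "j + m = n" "A \<in> av_graphs a (b + m) j" "B \<in> av_graphs (a + Suc j) b m"
    "P = join a b n j A B" using av_graphs_join[OF P(1)] by metis
  then have "A \<in> avoiders k a (b + m) j" "B \<in> avoiders (Suc k) (a + Suc j) b m"
    using P(2) num_chains_join[OF d(2,3), of k] by (auto simp: avoiders_def)
  moreover have "j \<le> n" "m = n - j" using d(1) by auto
  ultimately show "P \<in> ?R" using d(4) by fastforce
next
  fix P assume "P \<in> ?R"
  then obtain j A B where j: "j \<le> n" and "A \<in> avoiders k a (b + (n - j)) j"
    "B \<in> avoiders (Suc k) (a + Suc j) b (n - j)" and P: "P = join a b n j A B" by auto
  then have AB: "A \<in> av_graphs a (b + (n - j)) j" "B \<in> av_graphs (a + Suc j) b (n - j)"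
    and z: "num_chains k A = 0" "num_chains (Suc k) B = 0" by (auto simp: avoiders_def)
  moreover have "num_chains (Suc k) A = 0"
    using z finite_av_graph[OF AB(1)] num_chains_zero_Suc by blast
  ultimately show "P \<in> ?L"
    using join_mem[OF AB] num_chains_join[OF AB, of k] j by (simp add: avoiders_def P)
qed

lemma card_avoiders_Suc:
  "card (avoiders (Suc k) a b (Suc n)) =
    (\<Sum>j\<le>n. card (avoiders k a (b + (n - j)) j) * card (avoiders (Suc k) (a + Suc j) b (n - j)))"
proof -
  let ?S = "\<lambda>j. avoiders k a (b + (n - j)) j \<times> avoiders (Suc k) (a + Suc j) b (n - j)"
  have sub: "A \<in> av_graphs a (b + (n - j)) j" "B \<in> av_graphs (a + Suc j) b (n - j)"
    if "(A, B) \<in> ?S j" for A B j using that by (auto simp: avoiders_def)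
  have "case_prod (join a b n i) ` ?S i \<inter> case_prod (join a b n j) ` ?S j = {}"
    if "i \<noteq> j" "i \<le> n" "j \<le> n" for i j
  proof -
    have False if "(A, B) \<in> ?S i" "(A', B') \<in> ?S j" "join a b n i A B = join a b n j A' B'" for A B A' B'
      using join_index[OF that(3)] join_mem[OF sub[OF that(1)]] \<open>i \<noteq> j\<close> \<open>i \<le> n\<close> by auto
    then show ?thesis by fastforce
  qed
  moreover have "inj_on (case_prod (join a b n j)) (?S j)" if "j \<le> n" for j
  proof (rule inj_onI)
    fix p q assume pq: "p \<in> ?S j" "q \<in> ?S j" "case_prod (join a b n j) p = case_prod (join a b n j) q"
    then show "p = q"
      using join_inj[of "fst p" a b "n - j" j "snd p" "fst q" "snd q"] that
        sub[of "fst p" "snd p" j] sub[of "fst q" "snd q" j]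
      by (auto simp: split_beta prod_eq_iff)
  qed
  ultimately show ?thesis unfolding avoiders_Suc
    by (subst card_UN_disjoint) (auto simp: finite_avoiders card_image card_cartesian_product)
qed

text \<open>The recurrence determines the numbers, so no explicit translation of graphs is needed.\<close>
lemma card_avoiders_shift: "card (avoiders k a b n) = card (avoiders k 0 0 n)"
proof (induction n arbitrary: k a b rule: less_induct)
  case (less n)
  show ?case
  proof (cases "k = 0 \<or> n = 0")
    case True
    then show ?thesis by (cases k) (auto simp: avoiders_0_left avoiders_0)
  next
    case False
    then obtain l m where [simp]: "k = Suc l" "n = Suc m" by (metis not0_implies_Suc)
    have "card (avoiders l a (b + (m - j)) j) = card (avoiders l 0 (0 + (m - j)) j)"
      "card (avoiders (Suc l) (a + Suc j) b (m - j)) = card (avoiders (Suc l) (0 + Suc j) 0 (m - j))"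
      if "j \<le> m" for j
      using less[of j l] less[of "m - j" "Suc l"] that by (metis \<open>n = Suc m\<close> le_imp_less_Suc diff_le_self)+
    then show ?thesis by (simp add: card_avoiders_Suc)
  qed
qed

section \<open>Involutions\<close>

definition av_involutions :: "nat \<Rightarrow> nat \<Rightarrow> (nat \<times> nat) set set" where
  "av_involutions a n = {P \<in> av_graphs a a n. P\<inverse> = P}"

text \<open>The part right of the maximum is \<open>G\<close> followed by the mirror image of the
  whole left part, maximum included. With \<open>m\<close> points in \<open>G\<close> the total
  length is \<open>Suc n = 2 * Suc j + m\<close>.\<close>

definition sym_join :: "nat \<Rightarrow> nat \<Rightarrow> nat \<Rightarrow> (nat \<times> nat) set \<Rightarrow> (nat \<times> nat) set \<Rightarrow> (nat \<times> nat) set"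
  where "sym_join a n j A G = join a a n j A (G \<union> (insert (a + Suc j, a + Suc n) A)\<inverse>)"

context
  fixes a j m n :: nat and A G :: "(nat \<times> nat) set"
  assumes n: "n = j + (m + Suc j)"
    and A: "A \<in> av_graphs a (a + (m + Suc j)) j" and G: "G \<in> av_graphs (a + Suc j) (a + Suc j) m"
begin

lemma sym_join_left: "insert (a + Suc j, a + Suc n) A \<in> av_graphs a (a + (m + Suc j)) (Suc j)"
proof -
  have "a + Suc n = a + (m + Suc j) + Suc j" using n by simp
  then show ?thesis using av_graphs_insert_top[OF A] by (simp only:)
qed

lemma sym_join_right: "(insert (a + Suc j, a + Suc n) A)\<inverse> \<in> av_graphs (a + Suc j + m) a (Suc j)"
  using av_graphs_converse[OF sym_join_left] by (simp only: ac_simps)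

lemma sym_join_rest:
  "G \<union> (insert (a + Suc j, a + Suc n) A)\<inverse> \<in> av_graphs (a + Suc j) a (m + Suc j)"
  by (rule av_graphs_Un[OF G sym_join_right])

lemma sym_join_mem: "sym_join a n j A G \<in> av_graphs a a (Suc n)"
  using join_mem[OF A sym_join_rest] n by (simp add: sym_join_def)

lemma sym_join_converse: "G\<inverse> = G \<Longrightarrow> (sym_join a n j A G)\<inverse> = sym_join a n j A G"
  by (auto simp: sym_join_def join_def)

text \<open>The three blocks are pairwise incomparable, and the outer two are transposes of each
  other. The resulting factor 2 drives the parity argument in
  \<open>once_involutions_Suc\<close>.\<close>

lemma num_chains_sym_join:
  "num_chains (Suc k) (sym_join a n j A G) =
    2 * (num_chains (Suc k) A + num_chains k A) + num_chains (Suc k) G"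
proof -
  let ?L = "insert (a + Suc j, a + Suc n) A"
  have L: "num_chains (Suc k) ?L = num_chains (Suc k) A + num_chains k A"
  proof (rule num_chains_insert_top)
    fix p assume "p \<in> A"
    then show "strictly_below p (a + Suc j, a + Suc n)"
      using av_graphsD[OF A, of "fst p" "snd p"] n by (simp add: strictly_below_def)
  qed (fact finite_av_graph[OF A])
  have "num_chains (Suc k) (G \<union> ?L\<inverse>) = num_chains (Suc k) G + num_chains (Suc k) (?L\<inverse>)"
  proof (rule num_chains_Un)
    fix p q assume "p \<in> G" "q \<in> ?L\<inverse>"
    then have "fst p < fst q" "snd q < snd p"
      using av_graphsD[OF G, of "fst p" "snd p"] av_graphsD[OF sym_join_right, of "fst q" "snd q"]
      unfolding prod.collapse by linarith+
    then show "p \<noteq> q \<and> \<not> strictly_below p q \<and> \<not> strictly_below q p"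
      by (auto simp: strictly_below_def)
  qed (use finite_av_graph[OF G] finite_av_graph[OF sym_join_right] in blast)+
  moreover have "num_chains (Suc k) (sym_join a n j A G) =
      num_chains (Suc k) A + num_chains k A + num_chains (Suc k) (G \<union> ?L\<inverse>)"
    unfolding sym_join_def using num_chains_join[OF A sym_join_rest, of k] by (simp only: n)
  ultimately show ?thesis unfolding num_chains_converse L by simp
qed

end

text \<open>\<open>join_inj\<close> recovers \<open>A\<close> and the entire right part; the middle
  block then consists of the columns of the right part up to \<open>a + Suc j + m\<close>.\<close>

lemma sym_join_inj:
  assumes n: "n = j + (m + Suc j)"
    and A: "A \<in> av_graphs a (a + (m + Suc j)) j" "A' \<in> av_graphs a (a + (m + Suc j)) j"
    and G: "G \<in> av_graphs (a + Suc j) (a + Suc j) m" "G' \<in> av_graphs (a + Suc j) (a + Suc j) m"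
    and eq: "sym_join a n j A G = sym_join a n j A' G'"
  shows "A = A' \<and> G = G'"
proof -
  let ?R = "\<lambda>A. (insert (a + Suc j, a + Suc n) A)\<inverse>"
  have *: "A = A' \<and> G \<union> ?R A = G' \<union> ?R A'"
    by (rule join_inj[OF A(1) sym_join_rest[OF n A(1) G(1)] A(2) sym_join_rest[OF n A(2) G(2)]])
      (use eq in \<open>simp only: sym_join_def n\<close>)
  have G_eq: "H = {p \<in> H \<union> ?R A. fst p \<le> a + Suc j + m}"
    if H: "H \<in> av_graphs (a + Suc j) (a + Suc j) m" for H
  proof -
    have "fst p \<le> a + Suc j + m" if "p \<in> H" for p
      using av_graphsD(2)[OF H, of "fst p" "snd p"] that by simp
    moreover have "\<not> fst p \<le> a + Suc j + m" if "p \<in> ?R A" for p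
      using av_graphsD(1)[OF sym_join_right[OF n A(1) H], of "fst p" "snd p"] that
      by (simp only: prod.collapse not_le)
    ultimately show ?thesis by blast
  qed
  have "G = G'" using G_eq[OF G(1)] G_eq[OF G(2)] * by metis
  then show ?thesis using * by blast
qed

text \<open>An involution either fixes its largest element, or the part left of and including the maximum
  is mirrored into the part above it on the right, leaving an involution in the middle.\<close>
lemma av_involutions_cases:
  assumes "P \<in> av_involutions a (Suc n)"
  obtains (fixed) A where "A \<in> av_involutions a n" "P = join a a n n A {}"
  | (moved) j m A G where "n = j + (m + Suc j)" "A \<in> av_graphs a (a + (m + Suc j)) j"
      "G \<in> av_involutions (a + Suc j) m" "P = sym_join a n j A G"
proof -
  have P: "P \<in> av_graphs a a (Suc n)" and sym: "P\<inverse> = P"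
    using assms by (auto simp: av_involutions_def)
  obtain j m' A B where jm: "j + m' = n" and A: "A \<in> av_graphs a (a + m') j"
    and B: "B \<in> av_graphs (a + Suc j) a m'" and PAB: "P = join a a n j A B"
    and split: "\<And>x y. (x, y) \<in> P \<Longrightarrow> x \<le> a + Suc j \<longleftrightarrow> a + m' < y"
    and L: "insert (a + Suc j, a + Suc n) A = {p \<in> P. fst p \<le> a + Suc j}"
    and B_eq: "B = {p \<in> P. a + Suc j < fst p}"
    by (rule av_graphs_join[OF P]) (rule that)
  show ?thesis
  \<comment> \<open>If \<open>m'\<close> is zero, nothing stands to the right of the maximum, which
    is therefore a fixed point.\<close>
  proof (cases "m' = 0")
    case True
    then have "B = {}" using B av_graphs_0 by auto
    moreover have "j = n" using True jm by simp
    ultimately have P_eq: "P = insert (a + Suc n, a + Suc n) A"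
      using PAB by (simp add: join_def)
    have "(a + Suc n, a + Suc n) \<notin> A" using av_graphsD(2)[OF A, of "a + Suc n"] jm by auto
    then have A_eq: "A = P - {(a + Suc n, a + Suc n)}" using P_eq by blast
    have "A\<inverse> = P\<inverse> - {(a + Suc n, a + Suc n)}" unfolding A_eq by blast
    then have "A\<inverse> = A" unfolding sym A_eq .
    then show ?thesis
      using fixed[of A] A PAB True \<open>B = {}\<close> \<open>j = n\<close> by (simp add: av_involutions_def)
  next
    case False
    have "(a + Suc j, a + Suc n) \<in> P" by (simp add: PAB join_def)
    \<comment> \<open>The mirror image of the maximum lies beyond the cut, so its row is at most
      \<open>a + m'\<close>. Thus the right part has room for a mirrored block of
      \<open>Suc j\<close> points.\<close>
    then have "(a + Suc n, a + Suc j) \<in> P" using sym by blast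
    from split[OF this] have "Suc j \<le> m'" using False jm by simp
    then obtain m where m': "m' = m + Suc j" by (metis le_add_diff_inverse2)
    \<comment> \<open>Transposing the first cut gives a second one, through the right part, which
      separates the middle block from the mirrored block.\<close>
    have split': "x \<le> a + Suc j + m \<longleftrightarrow> a + Suc j < y" if "(x, y) \<in> B" for x y
    proof -
      have "(y, x) \<in> P" using that sym B_eq by blast
      then show ?thesis using split[of y x] m' by auto
    qed
    define G where "G = {p \<in> B. fst p \<le> a + Suc j + m}"
    have G: "G \<in> av_graphs (a + Suc j) (a + Suc j) m"
      unfolding G_def using av_graphs_split(1)[OF B[unfolded m'] split'] by blast
    have inP: "(y, x) \<in> P \<longleftrightarrow> (x, y) \<in> P" for x y using sym by blast
    have G_eq: "(x, y) \<in> G \<longleftrightarrow> (x, y) \<in> P \<and> a + Suc j < x \<and> a + Suc j < y" for x y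
      using split'[of x y] by (auto simp: G_def B_eq)
    have "G\<inverse> = G" by (auto simp: G_eq inP)
    moreover have "B = G \<union> {p \<in> P. fst p \<le> a + Suc j}\<inverse>"
    proof -
      have "(x, y) \<in> B \<longleftrightarrow> (x, y) \<in> G \<or> (y, x) \<in> P \<and> y \<le> a + Suc j" for x y
        using split[of y x] split[of x y] by (auto simp: G_eq B_eq inP m')
      then show ?thesis by auto
    qed
    ultimately have "G \<in> av_involutions (a + Suc j) m" "P = sym_join a n j A G"
      using G PAB by (simp_all only: av_involutions_def sym_join_def L mem_Collect_eq)
    then show ?thesis using moved jm A m' by blast
  qed
qed

section \<open>Counting the involutions with exactly one chain\<close>

definition once_involutions :: "nat \<Rightarrow> nat \<Rightarrow> nat \<Rightarrow> (nat \<times> nat) set set" where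
  "once_involutions k a n = {P \<in> av_involutions a n. num_chains k P = 1}"

lemma finite_av_involutions: "finite (av_involutions a n)"
  by (simp add: av_involutions_def finite_av_graphs)

lemma finite_once_involutions: "finite (once_involutions k a n)"
  by (simp add: once_involutions_def finite_av_involutions)

lemma once_involutions_0: "once_involutions (Suc k) a 0 = {}"
  by (auto simp: once_involutions_def av_involutions_def av_graphs_0)

text \<open>The involutions that acquire exactly one chain of length \<open>k + 1\<close> when a fixed point is added at
  the top.\<close>
definition near_once :: "nat \<Rightarrow> nat \<Rightarrow> nat \<Rightarrow> (nat \<times> nat) set set" where
  "near_once k a n = {P \<in> av_involutions a n. num_chains (Suc k) P + num_chains k P = 1}"

text \<open>The empty chain already accounts for the total of 1, so there may be no points at all.
  This is the source of the convention that \<open>I_0\<close> is 1.\<close>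

lemma near_once_0: "near_once 0 a n = (if n = 0 then {{}} else {})"
proof -
  have "n = 0" if P: "P \<in> av_graphs a a n" "card P = 0" for P
  proof (rule ccontr)
    assume "n \<noteq> 0"
    then obtain y where "(a + n, y) \<in> P" using av_graphs_Domain[OF P(1), of "a + n"] by auto
    then show False using P finite_av_graph[OF P(1)] by auto
  qed
  then show ?thesis by (auto simp: near_once_def av_involutions_def num_chains_1 av_graphs_0)
qed

text \<open>A chain of \<open>k + 2\<close> points would bring at least \<open>k + 2\<close> chains
  of \<open>k + 1\<close> points, so uniqueness of the shorter chain excludes the longer
  ones.\<close>

lemma near_once_Suc: "near_once (Suc k) a n = once_involutions (Suc k) a n"
proof -
  have "num_chains (Suc (Suc k)) P + num_chains (Suc k) P = 1 \<longleftrightarrow> num_chains (Suc k) P = 1"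
    if "finite P" for P
    using num_chains_Suc_pos[OF that, of "Suc k"] by linarith
  then show ?thesis
    by (auto simp: near_once_def once_involutions_def av_involutions_def dest: finite_av_graph)
qed

text \<open>The first set has a fixed maximum, the second a moved one. The bound
  \<open>Suc (2 * j) \<le> n\<close> says that two outer blocks of \<open>Suc j\<close> points fit
  into \<open>Suc n\<close> points.\<close>

lemma once_involutions_Suc:
  "once_involutions (Suc k) a (Suc n) = (\<lambda>A. join a a n n A {}) ` near_once k a n \<union>
    (\<Union>j\<in>{j. Suc (2 * j) \<le> n}. case_prod (sym_join a n j) `
      (avoiders k a (a + (n - j)) j \<times> once_involutions (Suc k) (a + Suc j) (n - Suc (2 * j))))"
  (is "?L = ?R1 \<union> ?R2")
proof (intro equalityI subsetI)
  fix P assume "P \<in> ?L"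
  then have P: "P \<in> av_involutions a (Suc n)" and one: "num_chains (Suc k) P = 1"
    by (auto simp: once_involutions_def)
  from P show "P \<in> ?R1 \<union> ?R2"
  proof (cases rule: av_involutions_cases)
    case (fixed A)
    then have "num_chains (Suc k) A + num_chains k A = 1"
      using one num_chains_join[of A a a 0 n "{}" k] by (simp add: av_involutions_def av_graphs_0)
    then show ?thesis using fixed by (auto simp: near_once_def)
  next
    case (moved j m A G)
    have G: "G \<in> av_graphs (a + Suc j) (a + Suc j) m"
      using moved(3) by (simp add: av_involutions_def)
    have "2 * (num_chains (Suc k) A + num_chains k A) + num_chains (Suc k) G = 1"
      using num_chains_sym_join[OF moved(1,2) G, of k] one moved(4) by simp
    \<comment> \<open>Over the naturals, \<open>2 * u + v = 1\<close> forces \<open>u = 0\<close>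
      and \<open>v = 1\<close>.\<close>
    then have "num_chains k A = 0" "num_chains (Suc k) G = 1" by presburger+
    moreover have "m + Suc j = n - j" "m = n - Suc (2 * j)" "Suc (2 * j) \<le> n"
      using moved(1) by simp_all
    ultimately have "(A, G) \<in> avoiders k a (a + (n - j)) j \<times>
        once_involutions (Suc k) (a + Suc j) (n - Suc (2 * j))"
      using moved(2,3) by (simp add: avoiders_def once_involutions_def)
    then show ?thesis using moved(4) \<open>Suc (2 * j) \<le> n\<close> by (intro UnI2) force
  qed
next
  fix P assume "P \<in> ?R1 \<union> ?R2"
  then consider A where "A \<in> near_once k a n" "P = join a a n n A {}"
    | j A G where "Suc (2 * j) \<le> n" "A \<in> avoiders k a (a + (n - j)) j"
      "G \<in> once_involutions (Suc k) (a + Suc j) (n - Suc (2 * j))" "P = sym_join a n j A G"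
    by auto
  then show "P \<in> ?L"
  proof cases
    case 1
    have A: "A \<in> av_graphs a (a + 0) n" and B: "{} \<in> av_graphs (a + Suc n) a 0"
      using 1 by (auto simp: near_once_def av_involutions_def av_graphs_0)
    have "A\<inverse> = A" using 1 by (simp add: near_once_def av_involutions_def)
    then have "P\<inverse> = P" by (auto simp: 1(2) join_def)
    then show ?thesis using join_mem[OF A B] num_chains_join[OF A B, of k] 1
      by (simp add: once_involutions_def av_involutions_def near_once_def)
  next
    case 2
    define m where "m = n - Suc (2 * j)"
    have n: "n = j + (m + Suc j)" and nj: "n - j = m + Suc j" using 2(1) by (simp_all add: m_def)
    have A: "A \<in> av_graphs a (a + (m + Suc j)) j" and A0: "num_chains k A = 0"
      using 2(2) nj by (auto simp: avoiders_def)
    have G: "G \<in> av_graphs (a + Suc j) (a + Suc j) m" and G': "G\<inverse> = G" "num_chains (Suc k) G = 1"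
      using 2(3) by (auto simp: once_involutions_def av_involutions_def m_def)
    have "num_chains (Suc k) A = 0" using A0 finite_av_graph[OF A] num_chains_zero_Suc by blast
    then have "num_chains (Suc k) P = 1"
      using num_chains_sym_join[OF n A G, of k] 2(4) A0 G' by simp
    then show ?thesis
      using sym_join_mem[OF n A G] sym_join_converse[OF n A G G'(1)] 2(4)
      by (simp add: once_involutions_def av_involutions_def)
  qed
qed

lemma card_once_involutions_Suc:
  "card (once_involutions (Suc k) a (Suc n)) = card (near_once k a n) +
    (\<Sum>j | Suc (2 * j) \<le> n. card (avoiders k a (a + (n - j)) j) *
      card (once_involutions (Suc k) (a + Suc j) (n - Suc (2 * j))))"
proof -
  let ?S = "\<lambda>j. avoiders k a (a + (n - j)) j \<times> once_involutions (Suc k) (a + Suc j) (n - Suc (2 * j))"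
  let ?m = "\<lambda>j. n - Suc (2 * j)"
  have arith: "n = j + (?m j + Suc j)" "n - j = ?m j + Suc j" if "Suc (2 * j) \<le> n" for j
    using that by simp_all
  have sub: "A \<in> av_graphs a (a + (?m j + Suc j)) j" "G \<in> av_graphs (a + Suc j) (a + Suc j) (?m j)"
    if "(A, G) \<in> ?S j" "Suc (2 * j) \<le> n" for A G j
    using that(1) arith(2)[OF that(2)] by (auto simp: avoiders_def once_involutions_def av_involutions_def)
  have mem: "sym_join a n j A G \<in> av_graphs a a (Suc n)"
    if "(A, G) \<in> ?S j" "Suc (2 * j) \<le> n" for A G j
    using sym_join_mem[OF arith(1)[OF that(2)] sub[OF that]] .
  \<comment> \<open>A fixed maximum stands in column \<open>a + Suc n\<close>, a moved one in column
    \<open>a + Suc j\<close> with \<open>j < n\<close>.\<close>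
  have disj: False if "join a a n n A B = sym_join a n j A' G" "(A', G) \<in> ?S j" "Suc (2 * j) \<le> n"
    for A B A' G j
  proof -
    have "join a a n n A B \<in> av_graphs a a (Suc n)" using mem[OF that(2,3)] that(1) by simp
    from join_index[OF that(1)[unfolded sym_join_def] this] show False using that(3) by simp
  qed
  have disj': "i = j" if "sym_join a n i A G = sym_join a n j A' G'" "(A', G') \<in> ?S j" "Suc (2 * j) \<le> n"
    for A G A' G' i j
  proof (rule join_index)
    have "sym_join a n i A G \<in> av_graphs a a (Suc n)" using mem[OF that(2,3)] that(1) by simp
    then show "join a a n i A (G \<union> (insert (a + Suc i, a + Suc n) A)\<inverse>) \<in> av_graphs a a (Suc n)"
      by (simp only: sym_join_def)
  qed (use that(1) in \<open>simp only: sym_join_def\<close>)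
  have fin: "finite {j. Suc (2 * j) \<le> n}" by (rule finite_subset[of _ "{..n}"]) auto
  have "card (\<Union>j\<in>{j. Suc (2 * j) \<le> n}. case_prod (sym_join a n j) ` ?S j) =
      (\<Sum>j | Suc (2 * j) \<le> n. card (case_prod (sym_join a n j) ` ?S j))"
  proof (rule card_UN_disjoint[OF fin])
    show "\<forall>i\<in>{j. Suc (2 * j) \<le> n}. finite (case_prod (sym_join a n i) ` ?S i)"
      by (simp add: finite_avoiders finite_once_involutions)
    show "\<forall>i\<in>{j. Suc (2 * j) \<le> n}. \<forall>j\<in>{j. Suc (2 * j) \<le> n}. i \<noteq> j \<longrightarrow>
        case_prod (sym_join a n i) ` ?S i \<inter> case_prod (sym_join a n j) ` ?S j = {}"
    proof (intro ballI impI equals0I)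
      fix i j P assume j: "j \<in> {j. Suc (2 * j) \<le> n}" and "i \<noteq> j"
        and "P \<in> case_prod (sym_join a n i) ` ?S i \<inter> case_prod (sym_join a n j) ` ?S j"
      then obtain A G A' G' where "P = sym_join a n i A G" "P = sym_join a n j A' G'" "(A', G') \<in> ?S j"
        by (elim IntE imageE) (auto simp only: split_paired_all prod.case)
      then show False using disj'[of i A G j A' G'] j \<open>i \<noteq> j\<close> by simp
    qed
  qed
  also have "\<dots> = (\<Sum>j | Suc (2 * j) \<le> n. card (avoiders k a (a + (n - j)) j) *
      card (once_involutions (Suc k) (a + Suc j) (n - Suc (2 * j))))"
  proof (rule sum.cong[OF refl])
    fix j assume "j \<in> {j. Suc (2 * j) \<le> n}"
    then have j: "Suc (2 * j) \<le> n" by simp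
    have "inj_on (case_prod (sym_join a n j)) (?S j)"
    proof (rule inj_onI)
      fix p q assume p: "p \<in> ?S j" and q: "q \<in> ?S j"
        and eq: "case_prod (sym_join a n j) p = case_prod (sym_join a n j) q"
      obtain A G A' G' where pq: "p = (A, G)" "q = (A', G')" by (cases p, cases q)
      show "p = q"
        using sym_join_inj[OF arith(1)[OF j] sub(1)[OF p[unfolded pq] j] sub(1)[OF q[unfolded pq] j]
            sub(2)[OF p[unfolded pq] j] sub(2)[OF q[unfolded pq] j]] eq pq by simp
    qed
    then show "card (case_prod (sym_join a n j) ` ?S j) = card (avoiders k a (a + (n - j)) j) *
      card (once_involutions (Suc k) (a + Suc j) (n - Suc (2 * j)))"
      by (simp add: card_image card_cartesian_product)
  qed
  finally have 2: "card (\<Union>j\<in>{j. Suc (2 * j) \<le> n}. case_prod (sym_join a n j) ` ?S j) =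
      (\<Sum>j | Suc (2 * j) \<le> n. card (avoiders k a (a + (n - j)) j) *
        card (once_involutions (Suc k) (a + Suc j) (n - Suc (2 * j))))" .
  have 1: "card ((\<lambda>A. join a a n n A {}) ` near_once k a n) = card (near_once k a n)"
  proof (rule card_image, rule inj_onI)
    fix A A' assume *: "A \<in> near_once k a n" "A' \<in> near_once k a n" "join a a n n A {} = join a a n n A' {}"
    have "{} \<in> av_graphs (a + Suc n) a 0" "A \<in> av_graphs a (a + 0) n" "A' \<in> av_graphs a (a + 0) n"
      using * by (auto simp: near_once_def av_involutions_def av_graphs_0)
    then show "A = A'" using join_inj[of A a a 0 n "{}" A' "{}"] *(3) by simp
  qed
  have "finite (near_once k a n)" by (simp add: near_once_def finite_av_involutions)
  moreover have "(\<lambda>A. join a a n n A {}) ` near_once k a n \<inter>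
      (\<Union>j\<in>{j. Suc (2 * j) \<le> n}. case_prod (sym_join a n j) ` ?S j) = {}"
  proof (intro equals0I)
    fix P assume "P \<in> (\<lambda>A. join a a n n A {}) ` near_once k a n \<inter>
      (\<Union>j\<in>{j. Suc (2 * j) \<le> n}. case_prod (sym_join a n j) ` ?S j)"
    then obtain A j A' G where "P = join a a n n A {}" "P = sym_join a n j A' G" "(A', G) \<in> ?S j"
        "Suc (2 * j) \<le> n"
      by (elim IntE UN_E imageE) (auto simp only: split_paired_all prod.case mem_Collect_eq)
    then show False using disj[of A "{}" j A' G] by simp
  qed
  ultimately show ?thesis unfolding once_involutions_Suc 1[symmetric] 2[symmetric]
    by (intro card_Un_disjoint) (simp_all add: fin finite_avoiders finite_once_involutions)
qed

text \<open>The recurrence again determines the numbers. The induction is over all \<open>k\<close>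
  at once because the fixed-point term refers to the preceding \<open>k\<close>.\<close>

lemma card_once_involutions_shift:
  "card (once_involutions (Suc k) a n) = card (once_involutions (Suc k) 0 n)"
proof (induction n arbitrary: k a rule: less_induct)
  case (less n)
  show ?case
  proof (cases n)
    case 0
    then show ?thesis by (simp add: once_involutions_0)
  next
    case (Suc m)
    have "card (near_once k a m) = card (near_once k 0 m)"
      using less[of m] Suc by (cases k) (simp_all add: near_once_0 near_once_Suc)
    moreover have "card (once_involutions (Suc k) (a + Suc j) (m - Suc (2 * j))) =
        card (once_involutions (Suc k) (0 + Suc j) (m - Suc (2 * j)))" for j
      using less[of "m - Suc (2 * j)" k "a + Suc j"] less[of "m - Suc (2 * j)" k "0 + Suc j"] Suc by simp
    moreover have "card (avoiders k a (a + (m - j)) j) = card (avoiders k 0 (0 + (m - j)) j)" for j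
      using card_avoiders_shift[of k a] card_avoiders_shift[of k 0 "0 + (m - j)"] by simp
    ultimately show ?thesis unfolding Suc card_once_involutions_Suc by (simp only:)
  qed
qed

section \<open>Occurrences as chains\<close>

definition fun_graph :: "nat \<Rightarrow> (nat \<Rightarrow> nat) \<Rightarrow> (nat \<times> nat) set" where
  "fun_graph n \<alpha> = (\<lambda>i. (i, \<alpha> i)) ` {1..n}"

lemma mem_fun_graph: "(x, y) \<in> fun_graph n \<alpha> \<longleftrightarrow> 1 \<le> x \<and> x \<le> n \<and> y = \<alpha> x"
  by (auto simp: fun_graph_def)

lemma order_isomorphic_upt:
  "order_isomorphic xs [1..<k + 1] \<longleftrightarrow> length xs = k \<and> (\<forall>a<k. \<forall>b<k. xs ! a < xs ! b \<longleftrightarrow> a < b)"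
  by (auto simp: order_isomorphic_def nth_upt simp del: upt_Suc)

lemma occurrences_upt:
  "occurrences [1..<k + 1] n \<alpha> = {xs. sorted_wrt (<) xs \<and> set xs \<subseteq> {1..n} \<and> length xs = k \<and>
    (\<forall>i<k. \<forall>j<k. \<alpha> (xs ! i) < \<alpha> (xs ! j) \<longleftrightarrow> i < j)}"
  unfolding occurrences_def order_isomorphic_upt by auto

lemma sorted_wrt_nth_less_iff:
  fixes xs :: "nat list"
  assumes "sorted_wrt (<) xs" "i < length xs" "j < length xs"
  shows "xs ! i < xs ! j \<longleftrightarrow> i < j"
  using sorted_wrt_nth_less[OF assms(1), of i j] sorted_wrt_nth_less[OF assms(1), of j i] assms(2,3)
  by (cases i j rule: linorder_cases) auto

text \<open>An occurrence corresponds to the set of points above its indices; the indices are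
  recovered as the increasing list of first coordinates.\<close>

lemma card_occurrences_upt: "card (occurrences [1..<k + 1] n \<alpha>) = num_chains k (fun_graph n \<alpha>)"
proof -
  let ?g = "\<lambda>js. (\<lambda>i. (i, \<alpha> i)) ` set js"
  have chain: "?g js \<in> chains k (fun_graph n \<alpha>)" if js: "js \<in> occurrences [1..<k + 1] n \<alpha>" for js
  proof -
    have sorted: "sorted_wrt (<) js" and sub: "set js \<subseteq> {1..n}" and len: "length js = k"
      and iso: "\<And>i j. i < k \<Longrightarrow> j < k \<Longrightarrow> \<alpha> (js ! i) < \<alpha> (js ! j) \<longleftrightarrow> i < j"
      using js unfolding occurrences_upt by auto
    have "card (?g js) = k"
      using sorted len strict_sorted_iff distinct_card by (subst card_image) (auto intro: inj_onI)
    moreover have "p = q \<or> strictly_below p q \<or> strictly_below q p" if "p \<in> ?g js" "q \<in> ?g js" for p q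
    proof -
      from that len obtain i j where "i < k" "j < k" "p = (js ! i, \<alpha> (js ! i))" "q = (js ! j, \<alpha> (js ! j))"
        by (auto simp: in_set_conv_nth)
      then show ?thesis
        using iso[of i j] iso[of j i] sorted_wrt_nth_less_iff[OF sorted, of i j]
          sorted_wrt_nth_less_iff[OF sorted, of j i] len
        by (cases i j rule: linorder_cases) (auto simp: strictly_below_def)
    qed
    ultimately show ?thesis using sub by (auto simp: chains_def fun_graph_def)
  qed
  have inj: "inj_on ?g (occurrences [1..<k + 1] n \<alpha>)"
  proof (rule inj_onI)
    fix xs ys assume "xs \<in> occurrences [1..<k + 1] n \<alpha>" "ys \<in> occurrences [1..<k + 1] n \<alpha>"
      and eq: "?g xs = ?g ys"
    then have "sorted_wrt (<) xs" "sorted_wrt (<) ys" by (auto simp: occurrences_def)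
    moreover have "set xs = set ys" using arg_cong[OF eq, of "image fst"] by (simp add: image_image)
    ultimately show "xs = ys" by (simp add: strict_sorted_equal)
  qed
  have "C \<in> ?g ` occurrences [1..<k + 1] n \<alpha>" if C: "C \<in> chains k (fun_graph n \<alpha>)" for C
  proof -
    define xs where "xs = sorted_list_of_set (fst ` C)"
    have sub: "C \<subseteq> fun_graph n \<alpha>" and fin: "finite C" and card: "card C = k"
      and comp: "\<And>p q. p \<in> C \<Longrightarrow> q \<in> C \<Longrightarrow> p = q \<or> strictly_below p q \<or> strictly_below q p"
      using C by (auto simp: chains_def)
    have set: "set xs = fst ` C" and sorted: "sorted_wrt (<) xs"
      using fin by (simp_all add: xs_def)
    have C_eq: "p = (fst p, \<alpha> (fst p))" if "p \<in> C" for p using that sub by (auto simp: fun_graph_def)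
    have "inj_on fst C" by (rule inj_onI) (metis C_eq)
    then have len: "length xs = k" using card by (simp add: xs_def card_image)
    have inC: "(xs ! i, \<alpha> (xs ! i)) \<in> C" if "i < k" for i
    proof -
      have "xs ! i \<in> fst ` C" using that len set nth_mem by blast
      then show ?thesis using C_eq by force
    qed
    have up: "\<alpha> (xs ! i) < \<alpha> (xs ! j)" if "i < j" "j < k" for i j
      using comp[OF inC[of i] inC[of j]] sorted_wrt_nth_less[OF sorted that(1)] that len
      by (auto simp: strictly_below_def)
    have "\<alpha> (xs ! i) < \<alpha> (xs ! j) \<longleftrightarrow> i < j" if "i < k" "j < k" for i j
      using up[of i j] up[of j i] that by (cases i j rule: linorder_cases) auto
    moreover have "set xs \<subseteq> {1..n}" using sub by (auto simp: set fun_graph_def)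
    ultimately have "xs \<in> occurrences [1..<k + 1] n \<alpha>"
      using sorted len unfolding occurrences_upt by simp
    moreover have "C = ?g xs"
    proof -
      have "?g xs = (\<lambda>p. (fst p, \<alpha> (fst p))) ` C" by (simp add: set image_image)
      also have "\<dots> = C" using C_eq by force
      finally show ?thesis by simp
    qed
    ultimately show ?thesis by blast
  qed
  with chain have "?g ` occurrences [1..<k + 1] n \<alpha> = chains k (fun_graph n \<alpha>)" by blast
  then show ?thesis unfolding num_chains_def using card_image[OF inj] by simp
qed

lemma avoids_132_iff:
  "avoids [1, 3, 2] n \<alpha> \<longleftrightarrow> avoids132 (fun_graph n \<alpha>)"
proof -
  have iso: "order_isomorphic (map \<alpha> [i, j, l]) [1, 3, 2] \<longleftrightarrow> \<alpha> i < \<alpha> l \<and> \<alpha> l < \<alpha> j" for i j l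
    by (auto simp: order_isomorphic_def All_less_Suc numeral_3_eq_3 less_Suc_eq)
  have mem: "[i, j, l] \<in> occurrences [1, 3, 2] n \<alpha> \<longleftrightarrow> i < j \<and> j < l \<and> {i, j, l} \<subseteq> {1..n} \<and>
      \<alpha> i < \<alpha> l \<and> \<alpha> l < \<alpha> j" for i j l
    unfolding occurrences_def mem_Collect_eq iso by auto
  have "\<exists>i j l. js = [i, j, l]" if "js \<in> occurrences [1, 3, 2] n \<alpha>" for js
  proof -
    have "length js = Suc (Suc (Suc 0))" using that by (simp add: occurrences_def order_isomorphic_def)
    then show ?thesis by (auto simp: length_Suc_conv)
  qed
  then have "avoids [1, 3, 2] n \<alpha> \<longleftrightarrow> (\<forall>i j l. [i, j, l] \<notin> occurrences [1, 3, 2] n \<alpha>)"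
    unfolding avoids_def by blast
  also have "\<dots> \<longleftrightarrow> avoids132 (fun_graph n \<alpha>)"
    unfolding mem avoids132_def mem_fun_graph by auto
  finally show ?thesis .
qed

lemma inv_eq_iff_fun_graph:
  assumes \<alpha>: "\<alpha> permutes {1..n}"
  shows "inv \<alpha> = \<alpha> \<longleftrightarrow> (fun_graph n \<alpha>)\<inverse> = fun_graph n \<alpha>"
proof
  assume inv: "inv \<alpha> = \<alpha>"
  have "\<alpha> (\<alpha> x) = x" for x using permutes_inverses(1)[OF \<alpha>] inv by metis
  moreover have "x \<in> {1..n} \<Longrightarrow> \<alpha> x \<in> {1..n}" for x using permutes_in_image[OF \<alpha>] by blast
  ultimately show "(fun_graph n \<alpha>)\<inverse> = fun_graph n \<alpha>" by (fastforce simp: mem_fun_graph)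
next
  assume eq: "(fun_graph n \<alpha>)\<inverse> = fun_graph n \<alpha>"
  have "\<alpha> (\<alpha> x) = x" for x
  proof (cases "x \<in> {1..n}")
    case True
    then have "(\<alpha> x, x) \<in> fun_graph n \<alpha>" by (subst eq[symmetric]) (simp add: mem_fun_graph)
    then show ?thesis by (simp add: mem_fun_graph)
  next
    case False
    then show ?thesis using \<alpha> by (simp add: permutes_def)
  qed
  then show "inv \<alpha> = \<alpha>" by (intro inv_unique_comp) (auto simp: fun_eq_iff)
qed

lemma matching_fun_graph:
  assumes \<alpha>: "\<alpha> permutes {1..n}"
  shows "matching {0<..n} {0<..n} (fun_graph n \<alpha>)"
proof -
  have "\<alpha> ` {1..n} = {1..n}" by (rule permutes_image[OF \<alpha>])
  moreover have "inj \<alpha>" by (rule permutes_inj[OF \<alpha>])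
  moreover have "Domain (fun_graph n \<alpha>) = {1..n}" "Range (fun_graph n \<alpha>) = \<alpha> ` {1..n}"
    by (auto simp: fun_graph_def)
  ultimately show ?thesis
    by (auto simp: matching_def single_valued_def mem_fun_graph dest: injD)
qed

lemma matching_imp_fun_graph:
  assumes P: "matching {0<..n} {0<..n} P"
  obtains \<alpha> where "\<alpha> permutes {1..n}" "P = fun_graph n \<alpha>"
proof -
  \<comment> \<open>Being the identity outside \<open>{1..n}\<close> is part of
    \<open>permutes\<close>, so the extension of the relation to a total function is forced.\<close>
  define \<alpha> where "\<alpha> x = (if x \<in> {1..n} then THE y. (x, y) \<in> P else x)" for x
  have dom: "Domain P = {1..n}" and ran: "Range P = {1..n}" using P by (auto simp: matching_def)
  have uniq: "y = y'" if "(x, y) \<in> P" "(x, y') \<in> P" for x y y'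
    using P that unfolding matching_def single_valued_def by blast
  have uniq': "x = x'" if "(x, y) \<in> P" "(x', y) \<in> P" for x x' y
    using P that unfolding matching_def single_valued_def by blast
  have \<alpha>_eq: "\<alpha> x = y" if "(x, y) \<in> P" for x y
  proof -
    have "x \<in> {1..n}" using that dom by blast
    then show ?thesis using that uniq by (auto simp: \<alpha>_def intro!: the_equality)
  qed
  have \<alpha>_mem: "(x, \<alpha> x) \<in> P" if x: "x \<in> {1..n}" for x
  proof -
    obtain y where "(x, y) \<in> P" using x dom by blast
    then show ?thesis using \<alpha>_eq by simp
  qed
  have "bij_betw \<alpha> {1..n} {1..n}"
  proof (rule bij_betw_imageI)
    show "inj_on \<alpha> {1..n}" by (rule inj_onI) (metis \<alpha>_mem uniq')
    show "\<alpha> ` {1..n} = {1..n}"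
    proof (intro equalityI subsetI)
      fix y assume "y \<in> \<alpha> ` {1..n}"
      then show "y \<in> {1..n}" using \<alpha>_mem ran by blast
    next
      fix y assume "y \<in> {1..n}"
      then obtain x where x: "(x, y) \<in> P" using ran by blast
      then have "x \<in> {1..n}" using dom by blast
      then show "y \<in> \<alpha> ` {1..n}" using \<alpha>_eq[OF x] by blast
    qed
  qed
  moreover have "\<alpha> x = x" if "x \<notin> {1..n}" for x
    unfolding \<alpha>_def using that by (rule if_not_P)
  ultimately have "\<alpha> permutes {1..n}" by (rule bij_imp_permutes)
  moreover have "P = fun_graph n \<alpha>"
  proof -
    have "(x, y) \<in> P \<longleftrightarrow> x \<in> {1..n} \<and> y = \<alpha> x" for x y
      using \<alpha>_eq \<alpha>_mem dom by blast
    then show ?thesis by (auto simp: fun_graph_def)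
  qed
  ultimately show ?thesis using that by blast
qed

lemma card_involutions_once: "card (involutions_once [1..<k + 1] n) = card (once_involutions k 0 n)"
proof -
  have iff: "\<alpha> \<in> involutions_once [1..<k + 1] n \<longleftrightarrow> fun_graph n \<alpha> \<in> once_involutions k 0 n"
    if "\<alpha> permutes {1..n}" for \<alpha>
    using that matching_fun_graph[OF that] inv_eq_iff_fun_graph[OF that]
    unfolding involutions_once_def once_involutions_def av_involutions_def av_graphs_def
      contains_once_def card_occurrences_upt avoids_132_iff mem_Collect_eq add_0 by blast
  have perm: "\<alpha> permutes {1..n}" if "\<alpha> \<in> involutions_once [1..<k + 1] n" for \<alpha>
    using that by (simp add: involutions_once_def)
  have "bij_betw (fun_graph n) (involutions_once [1..<k + 1] n) (once_involutions k 0 n)"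
  proof (rule bij_betw_imageI)
    show "inj_on (fun_graph n) (involutions_once [1..<k + 1] n)"
    proof (rule inj_onI)
      fix \<alpha> \<beta> assume "\<alpha> \<in> involutions_once [1..<k + 1] n" "\<beta> \<in> involutions_once [1..<k + 1] n"
        and eq: "fun_graph n \<alpha> = fun_graph n \<beta>"
      then have perms: "\<alpha> permutes {1..n}" "\<beta> permutes {1..n}" using perm by blast+
      show "\<alpha> = \<beta>"
      proof
        fix x show "\<alpha> x = \<beta> x"
        proof (cases "x \<in> {1..n}")
          case True
          then have "(x, \<alpha> x) \<in> fun_graph n \<beta>" using eq by (simp add: mem_fun_graph flip: eq)
          then show ?thesis by (simp add: mem_fun_graph)
        next
          case False
          then show ?thesis using perms by (simp add: permutes_def)
        qed
      qed
    qed
    show "fun_graph n ` involutions_once [1..<k + 1] n = once_involutions k 0 n"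
    proof (intro equalityI subsetI)
      fix P assume P: "P \<in> once_involutions k 0 n"
      then have "matching {0<..n} {0<..n} P"
        by (simp add: once_involutions_def av_involutions_def av_graphs_def)
      then obtain \<alpha> where "\<alpha> permutes {1..n}" "P = fun_graph n \<alpha>" by (rule matching_imp_fun_graph)
      then show "P \<in> fun_graph n ` involutions_once [1..<k + 1] n" using iff P by blast
    qed (use iff perm in blast)
  qed
  then show ?thesis by (rule bij_betw_same_card)
qed

section \<open>Generating functions\<close>

definition avoiders_gf :: "nat \<Rightarrow> real fps" where
  "avoiders_gf k = Abs_fps (\<lambda>n. of_nat (card (avoiders k 0 0 n)))"

lemma avoiders_gf_0: "avoiders_gf 0 = 0"
  by (simp add: avoiders_gf_def avoiders_0_left fps_eq_iff)

text \<open>The constant term is the empty permutation. Once the offsets are removed by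
  \<open>card_avoiders_shift\<close>, \<open>card_avoiders_Suc\<close> is a Cauchy product, and
  \<open>fps_X\<close> accounts for the maximum.\<close>

lemma avoiders_gf_Suc: "avoiders_gf (Suc k) = 1 + fps_X * (avoiders_gf k * avoiders_gf (Suc k))"
proof (rule fps_ext)
  fix n
  have *: "card (avoiders k 0 (0 + (m - j)) j) * card (avoiders (Suc k) (0 + Suc j) 0 (m - j)) =
      card (avoiders k 0 0 j) * card (avoiders (Suc k) 0 0 (m - j))" for m j
    using card_avoiders_shift[of k 0 "0 + (m - j)" j] card_avoiders_shift[of "Suc k" "0 + Suc j" 0 "m - j"]
    by simp
  show "avoiders_gf (Suc k) $ n = (1 + fps_X * (avoiders_gf k * avoiders_gf (Suc k))) $ n"
  proof (cases n)
    case 0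
    then show ?thesis by (simp add: avoiders_gf_def avoiders_0)
  next
    case (Suc m)
    have "avoiders_gf (Suc k) $ n =
        (\<Sum>j\<le>m. real (card (avoiders k 0 0 j)) * real (card (avoiders (Suc k) 0 0 (m - j))))"
      by (simp only: Suc avoiders_gf_def fps_nth_Abs_fps card_avoiders_Suc * of_nat_sum of_nat_mult)
    also have "\<dots> = (avoiders_gf k * avoiders_gf (Suc k)) $ m"
      by (simp add: avoiders_gf_def fps_mult_nth atLeast0AtMost)
    also have "\<dots> = (1 + fps_X * (avoiders_gf k * avoiders_gf (Suc k))) $ n"
      by (simp add: Suc)
    finally show ?thesis .
  qed
qed

definition once_gf :: "nat \<Rightarrow> real fps" where
  "once_gf k = Abs_fps (\<lambda>n. of_nat (card (once_involutions k 0 n)))"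

text \<open>The avoider enters at \<open>fps_X ^ 2\<close> because each of its points occurs twice,
  and the further \<open>fps_X ^ 2\<close> stands for the maximum and its mirror image. The case
  distinction is genuine: every graph has exactly one empty chain, so \<open>once_gf 0\<close>
  counts all 132-avoiding involutions and is not the required 1.\<close>

lemma once_gf_Suc:
  "once_gf (Suc k) = (if k = 0 then fps_X else fps_X * once_gf k) +
    fps_X ^ 2 * ((avoiders_gf k oo fps_X ^ 2) * once_gf (Suc k))"
  (is "_ = ?near + fps_X ^ 2 * (?E * _)")
proof (rule fps_ext)
  fix n
  show "once_gf (Suc k) $ n = (?near + fps_X ^ 2 * (?E * once_gf (Suc k))) $ n"
  proof (cases n)
    case 0
    then show ?thesis by (simp add: once_gf_def once_involutions_0 fps_mult_nth)
  next
    case (Suc m)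
    have near: "real (card (near_once k 0 m)) = ?near $ n"
      by (cases k) (auto simp: near_once_0 near_once_Suc Suc once_gf_def)
    have "(\<Sum>j | Suc (2 * j) \<le> m. real (card (avoiders k 0 (0 + (m - j)) j)) *
        real (card (once_involutions (Suc k) (0 + Suc j) (m - Suc (2 * j))))) =
      (\<Sum>j | Suc (2 * j) \<le> m. avoiders_gf k $ j * once_gf (Suc k) $ (m - Suc (2 * j)))"
      unfolding card_avoiders_shift[of k 0 "0 + (m - _)"] card_once_involutions_shift[of k "0 + Suc _"]
      by (simp add: avoiders_gf_def once_gf_def)
    also have "\<dots> = (fps_X ^ 2 * (?E * once_gf (Suc k))) $ n"
    proof (cases m)
      case 0
      then show ?thesis by (simp add: Suc fps_X_power_mult_nth)
    next
      case (Suc l)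
      let ?h = "\<lambda>i. ?E $ i * once_gf (Suc k) $ (l - i)"
      have "(\<Sum>j | Suc (2 * j) \<le> m. avoiders_gf k $ j * once_gf (Suc k) $ (m - Suc (2 * j))) =
          (\<Sum>j | 2 * j \<le> l. ?h (2 * j))"
        by (simp add: Suc fps_nth_compose_X_power)
      also have "\<dots> = sum ?h ((\<lambda>j. 2 * j) ` {j. 2 * j \<le> l})"
        by (subst sum.reindex) (auto intro: inj_onI)
      \<comment> \<open>The odd coefficients of a series in \<open>fps_X ^ 2\<close> vanish, so the
        sum over even indices is already the full Cauchy product.\<close>
      also have "\<dots> = sum ?h {0..l}"
        by (rule sum.mono_neutral_left) (auto simp: fps_nth_compose_X_power elim!: evenE)
      also have "\<dots> = (fps_X ^ 2 * (?E * once_gf (Suc k))) $ n"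
        unfolding fps_mult_nth[symmetric] by (simp add: \<open>n = Suc m\<close> Suc fps_X_power_mult_nth)
      finally show ?thesis .
    qed
    finally have moved: "(\<Sum>j | Suc (2 * j) \<le> m. real (card (avoiders k 0 (0 + (m - j)) j)) *
        real (card (once_involutions (Suc k) (0 + Suc j) (m - Suc (2 * j))))) =
      (fps_X ^ 2 * (?E * once_gf (Suc k))) $ n" .
    have "once_gf (Suc k) $ n = real (card (once_involutions (Suc k) 0 (Suc m)))"
      by (simp add: once_gf_def Suc)
    then show ?thesis
      unfolding card_once_involutions_Suc of_nat_add of_nat_sum of_nat_mult near moved fps_add_nth .
  qed
qed

section \<open>Chebyshev polynomials at \<open>1/(2x)\<close> and the solution of the
  recurrences\<close>

lemma chebyshev_U_eqI:
  assumes "\<And>\<theta>. sin \<theta> \<noteq> 0 \<Longrightarrow> poly p (cos \<theta>) = sin ((real r + 1) * \<theta>) / sin \<theta>"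
  shows "chebyshev_U r = p"
  by (rule chebyshev_U_unique[of _ r]) (use assms chebyshev_U_cos in auto)

lemma chebyshev_U_0: "chebyshev_U 0 = 1"
  by (rule chebyshev_U_eqI) simp

lemma chebyshev_U_1: "chebyshev_U (Suc 0) = [:0, 2:]"
  by (rule chebyshev_U_eqI) (simp add: sin_double)

text \<open>This is \<open>sin (y + t) + sin (y - t) = 2 * sin y * cos t\<close> with
  \<open>y = (r + 2) * t\<close>, divided by \<open>sin t\<close>.\<close>

lemma chebyshev_U_Suc_Suc:
  "chebyshev_U (Suc (Suc r)) = [:0, 2:] * chebyshev_U (Suc r) - chebyshev_U r"
proof (rule chebyshev_U_eqI)
  fix \<theta> :: real
  assume nz: "sin \<theta> \<noteq> 0"
  define y where "y = (real (Suc r) + 1) * \<theta>"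
  have 1: "(real (Suc (Suc r)) + 1) * \<theta> = y + \<theta>" and 2: "(real r + 1) * \<theta> = y - \<theta>"
    by (simp_all add: y_def algebra_simps)
  show "poly ([:0, 2:] * chebyshev_U (Suc r) - chebyshev_U r) (cos \<theta>) =
      sin ((real (Suc (Suc r)) + 1) * \<theta>) / sin \<theta>"
    using chebyshev_U_cos[OF nz, of "Suc r", folded y_def] chebyshev_U_cos[OF nz, of r, unfolded 2] nz
    unfolding 1 by (simp add: sin_add sin_diff field_simps)
qed

lemma poly_fls_diff: "poly_fls (p - q) x = poly_fls p x - poly_fls q x"
proof -
  have "map_poly fls_const (p - q) = map_poly fls_const p - map_poly fls_const q"
    by (rule poly_eqI) (simp add: coeff_map_poly fls_minus_const)
  then show ?thesis by (simp add: poly_fls_def)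
qed

lemma poly_fls_2X: "poly_fls ([:0, 2:] * p) x = 2 * x * poly_fls p x"
proof -
  have "map_poly fls_const ([:0, 2:] * p) = pCons 0 (smult 2 (map_poly fls_const p))"
    by (rule poly_eqI)
      (simp add: coeff_map_poly coeff_pCons split: nat.split flip: fls_const_mult_const)
  then show ?thesis by (simp add: poly_fls_def)
qed

abbreviation (input) U_fls :: "nat \<Rightarrow> real fls" where
  "U_fls k \<equiv> poly_fls (chebyshev_U k) (1 / (2 * fls_X))"

text \<open>At the argument \<open>1 / (2 * fls_X)\<close> the factor contributed by
  \<open>[:0, 2:]\<close> is the inverse of \<open>fls_X\<close>. Multiplying by
  \<open>fls_X\<close> thus frees the Chebyshev recurrence from division.\<close>

lemma fls_X_poly_fls_2X: "fls_X * poly_fls ([:0, 2:] * p) (1 / (2 * fls_X)) = poly_fls p (1 / (2 * fls_X))"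
proof -
  define x :: "real fls" where "x = 1 / (2 * fls_X)"
  have "(2 * fls_X) * x = 1" unfolding x_def by (simp only: times_divide_eq_right mult_1_right) (rule divide_self, simp)
  then have "fls_X * (2 * x * q) = q" for q by (metis mult.assoc mult.commute mult_1)
  then show ?thesis by (simp add: poly_fls_2X del: mult_pCons_left flip: x_def)
qed

lemma U_fls_0: "U_fls 0 = 1"
  by (simp add: chebyshev_U_0 poly_fls_def)

lemma U_fls_1: "fls_X * U_fls (Suc 0) = 1"
  using fls_X_poly_fls_2X[of 1] U_fls_0 unfolding chebyshev_U_1 chebyshev_U_0 mult_1_right by simp

lemma U_fls_Suc_Suc: "fls_X * U_fls (Suc (Suc k)) = U_fls (Suc k) - fls_X * U_fls k"
  unfolding chebyshev_U_Suc_Suc poly_fls_diff right_diff_distrib fls_X_poly_fls_2X ..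

abbreviation (input) E_fls :: "nat \<Rightarrow> real fls" where
  "E_fls k \<equiv> fps_to_fls (avoiders_gf k oo fps_X ^ 2)"

lemma E_fls_0: "E_fls 0 = 0"
  by (simp add: avoiders_gf_0)

text \<open>The recurrence of \<open>avoiders_gf_Suc\<close> with the terms in \<open>Suc k\<close>
  collected. It exhibits the inverse of \<open>1 - fls_X ^ 2 * E_fls k\<close>, the factor that also
  governs \<open>once_fls_Suc\<close>.\<close>

lemma E_fls_Suc: "E_fls (Suc k) * (1 - fls_X ^ 2 * E_fls k) = 1"
proof -
  have "avoiders_gf (Suc k) oo fps_X ^ 2 =
      1 + fps_X ^ 2 * ((avoiders_gf k oo fps_X ^ 2) * (avoiders_gf (Suc k) oo fps_X ^ 2))"
    by (subst avoiders_gf_Suc) (simp add: fps_compose_add_distrib fps_compose_mult_distrib)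
  from arg_cong[OF this, of fps_to_fls] show ?thesis
    by (simp add: fls_times_fps_to_fls fps_to_fls_power algebra_simps)
qed

lemma once_fls_Suc:
  "fps_to_fls (once_gf (Suc k)) * (1 - fls_X ^ 2 * E_fls k) =
    fls_X * (if k = 0 then 1 else fps_to_fls (once_gf k))"
  using arg_cong[OF once_gf_Suc, of fps_to_fls k]
  by (cases "k = 0") (simp_all add: fls_times_fps_to_fls fps_to_fls_power algebra_simps)

text \<open>The two equations feed each other: substituting the second, for \<open>k\<close>, into
  the three-term recurrence gives the first for \<open>Suc k\<close>, and multiplying that by
  \<open>E_fls (Suc (Suc k))\<close> gives the second.\<close>

lemma U_fls_E_fls:
  "fls_X * U_fls (Suc k) = U_fls k * (1 - fls_X ^ 2 * E_fls k) \<and>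
    fls_X * U_fls (Suc k) * E_fls (Suc k) = U_fls k"
proof (induction k)
  case 0
  show ?case using E_fls_Suc[of 0] by (simp add: U_fls_1 U_fls_0 E_fls_0)
next
  case (Suc k)
  have "fls_X * U_fls (Suc (Suc k)) = U_fls (Suc k) * (1 - fls_X ^ 2 * E_fls (Suc k))"
    unfolding U_fls_Suc_Suc using Suc by (simp add: algebra_simps power2_eq_square)
  then show ?case using E_fls_Suc[of "Suc k"] by (simp add: mult.assoc mult.commute)
qed

text \<open>The factor \<open>1 - fls_X ^ 2 * E_fls (Suc k)\<close> links consecutive terms of both
  sequences, upwards in one and downwards in the other, so their product does not change with
  \<open>k\<close>. It starts at 1 because the two series for \<open>k = 1\<close> are
  \<open>1/x\<close> and \<open>x\<close>.\<close>

lemma U_fls_once_fls: "U_fls (Suc k) * fps_to_fls (once_gf (Suc k)) = 1"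
proof (induction k)
  case 0
  show ?case using once_fls_Suc[of 0] U_fls_1 by (simp add: E_fls_0 mult.commute)
next
  case (Suc k)
  have "fls_X * (U_fls (Suc (Suc k)) * fps_to_fls (once_gf (Suc (Suc k)))) =
      U_fls (Suc k) * (fps_to_fls (once_gf (Suc (Suc k))) * (1 - fls_X ^ 2 * E_fls (Suc k)))"
    using U_fls_E_fls[of "Suc k"] by (simp add: mult.assoc mult.left_commute mult.commute)
  also have "\<dots> = fls_X * (U_fls (Suc k) * fps_to_fls (once_gf (Suc k)))"
    unfolding once_fls_Suc by simp
  finally show ?case using Suc by simp
qed

theorem theorem3p2:
  fixes k :: nat
  assumes "k \<ge> 1"
  shows "fps_to_fls (involutions_once_gf [1..<k + 1]) =
    1 / poly_fls (chebyshev_U k) (1 / (2 * fls_X))"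
proof -
  have "involutions_once_gf [1..<k + 1] = once_gf k"
    by (simp only: involutions_once_gf_def once_gf_def card_involutions_once)
  moreover obtain l where "k = Suc l" using assms by (cases k) auto
  ultimately have *: "U_fls k * fps_to_fls (involutions_once_gf [1..<k + 1]) = 1"
    using U_fls_once_fls by simp
  then have "U_fls k \<noteq> 0" by auto
  with * show ?thesis by (simp only: eq_divide_eq mult.commute not_False_eq_True if_True)
qed

end
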